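(* Let $T>0$ and $p>1$. Assume that $a\colon\mathbb{R}\to\mathbb{R}$ is a sign-changing continuous and $T$-periodic function, having a finite number of zeros in $[0,T)$ and satisfying the mean value condition $$\int_0^T a(t)\,dt<0.$$ Then the equation $$u''+a(t)u^{p}=0$$ has a positive $T$-periodic solution, as well as positive subharmonic solutions of order $k$ for any large integer $k$ (that is, there exists an integer $k^*\ge 1$ such that for every integer $k\ge k^*$ the equation has positive subharmonic solutions of order $k$).
   Context: A solution $u\colon\mathbb{R}\to\mathbb{R}$ is positive if $u(t)>0$ for every $t\in\mathbb{R}$. For an integer $k\ge1$, a subharmonic solution of order $k$ of an ODE with $T$-periodic time dependence is a $kT$-periodic solution $u(t)$ (defined on $\mathbb{R}$) which is not $lT$-periodic for any integer $l=1,\ldots,k-1$. Sign-changing means that $a$ takes both positive and negative values. *)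

theory Defs
  imports "HOL-Analysis.Analysis" "HOL-Library.Periodic_Fun"
begin

(* A classical global solution of u'' + a(t) u^p = 0. The value of powr at negative bases is
   irrelevant, because solutions are only asserted together with everywhere_positive. *)
definition solution :: "(real \<Rightarrow> real) \<Rightarrow> real \<Rightarrow> (real \<Rightarrow> real) \<Rightarrow> bool" where
  "solution a p u \<longleftrightarrow>
     (\<exists>u' u''. \<forall>t. (u has_real_derivative u' t) (at t) \<and>
                (u' has_real_derivative u'' t) (at t) \<and>
                u'' t + a t * u t powr p = 0)"

definition everywhere_positive :: "(real \<Rightarrow> real) \<Rightarrow> bool" where
  "everywhere_positive u \<longleftrightarrow> (\<forall>t. u t > 0)"

definition sign_changing :: "(real \<Rightarrow> real) \<Rightarrow> bool" where
  "sign_changing a \<longleftrightarrow> (\<exists>t. a t > 0) \<and> (\<exists>t. a t < 0)"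

(* periodic_fun_simple f c says f (x + c) = f x for all x; c need not be the minimal period. *)
definition subharmonic_solution ::
  "(real \<Rightarrow> real) \<Rightarrow> real \<Rightarrow> real \<Rightarrow> nat \<Rightarrow> (real \<Rightarrow> real) \<Rightarrow> bool" where
  "subharmonic_solution a p T k u \<longleftrightarrow>
     k \<ge> 1 \<and>
     solution a p u \<and> periodic_fun_simple u (real k * T) \<and>
     (\<forall>l\<in>{1..<k}. \<not> periodic_fun_simple u (real l * T))"

end

theory Submission
  imports Defs "HOL-Complex_Analysis.Complex_Analysis" "HOL-Real_Asymp.Real_Asymp"
begin

text \<open>
  The equation is variational and its nonlinearity is homogeneous, so for every period
  \<open>L = k T\<close> a positive solution can be found as a ground state: maximise
  \<open>J(v) = \<integral> a v\<^sup>q\<close> over one period, with \<open>q = p + 1\<close>, among \<open>L\<close>-periodic functions of energy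
  \<open>\<integral> v'\<^sup>2 \<le> 1\<close>.  The negative mean of \<open>a\<close> bounds a maximising sequence: on a function that is large
  compared with its oscillation, \<open>J\<close> is negative.  Arzela--Ascoli then gives a maximiser, and \<open>J\<close>
  is positive there because a bump placed where \<open>a > 0\<close> is admissible.  A maximiser solves
  \<open>u'' = - a u\<^sup>p / M\<close> with \<open>M = max J\<close>, it is positive by uniqueness for the initial value problem
  at a zero of \<open>u \<ge> 0\<close>, and a constant multiple of it removes the factor \<open>1 / M\<close>.

  Subharmonics come from comparing energies.  Suppose that the ground state \<open>u\<close> of period \<open>k T\<close>
  also has the period \<open>d T\<close>, where \<open>k = m d\<close> and \<open>m \<ge> 2\<close>.  One copy of \<open>u\<close> carries energy \<open>1 / m\<close>
  and contributes \<open>M / m\<close> to \<open>J\<close>; if it could be isolated, maximality would force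
  \<open>M / m \<le> M m\<^bsup>- q/2\<^esup>\<close>, which is false since \<open>q > 2\<close>: concentrating on one copy is better than
  repeating it.  To isolate a copy, \<open>u\<close> must be brought to zero at its two ends at little cost.
  Splitting the copy into \<open>d\<close> cells of length \<open>T\<close> and estimating \<open>J\<close> cell by cell
  (lemma \<open>exists_small_cell\<close>) shows that \<open>m\<close> is bounded, hence \<open>d\<close> is large with \<open>k\<close>, and that
  some cell has \<open>u \<le> \<delta>\<close> with \<open>\<delta>\<close> tending to \<open>0\<close> as \<open>k\<close> grows.  Cutting \<open>u\<close> off linearly there
  gives the contradiction for all large \<open>k\<close> (lemma \<open>minimal_period_threshold\<close>).

  The energy bound \<open>\<integral> v'\<^sup>2 \<le> e\<close> on an interval is expressed by the existence of a function \<open>F\<close>, to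
  be thought of as the energy accumulated so far, which grows by at most \<open>e\<close> and satisfies the
  Cauchy--Schwarz inequality \<open>(v t - v s)\<^sup>2 \<le> (t - s) (F t - F s)\<close>.  This condition makes sense for an
  arbitrary function \<open>v\<close>, behaves well under gluing and under adding affine functions, and passes to
  pointwise limits; so it takes the place of a Sobolev space.
\<close>

section \<open>Functions of bounded energy\<close>

text \<open>
  For absolutely continuous \<open>v\<close> the best choice is \<open>F t = \<integral>\<^sub>x\<^sup>t v'\<^sup>2\<close>, so the predicate says
  \<open>\<integral> v'\<^sup>2 \<le> e\<close> over \<open>{x..y}\<close>.  The cumulative form makes energy additive over adjacent intervals.
\<close>

definition energy_le :: "(real \<Rightarrow> real) \<Rightarrow> real \<Rightarrow> real \<Rightarrow> real \<Rightarrow> bool" where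
  "energy_le v x y e \<longleftrightarrow>
     (\<exists>F. F y - F x \<le> e \<and>
          (\<forall>s t. x \<le> s \<and> s \<le> t \<and> t \<le> y \<longrightarrow> (v t - v s)\<^sup>2 \<le> (t - s) * (F t - F s)))"

lemma energy_leI:
  assumes "F y - F x \<le> e"
    and "\<And>s t. x \<le> s \<Longrightarrow> s \<le> t \<Longrightarrow> t \<le> y \<Longrightarrow> (v t - v s)\<^sup>2 \<le> (t - s) * (F t - F s)"
  shows "energy_le v x y e"
  using assms unfolding energy_le_def by blast

lemma energy_leE:
  assumes "energy_le v x y e"
  obtains F where "F y - F x \<le> e"
    and "\<And>s t. x \<le> s \<Longrightarrow> s \<le> t \<Longrightarrow> t \<le> y \<Longrightarrow> (v t - v s)\<^sup>2 \<le> (t - s) * (F t - F s)"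
    and "\<And>s t. x \<le> s \<Longrightarrow> s \<le> t \<Longrightarrow> t \<le> y \<Longrightarrow> F s \<le> F t"
proof -
  obtain F where F: "F y - F x \<le> e"
    "\<And>s t. x \<le> s \<Longrightarrow> s \<le> t \<Longrightarrow> t \<le> y \<Longrightarrow> (v t - v s)\<^sup>2 \<le> (t - s) * (F t - F s)"
    using assms unfolding energy_le_def by blast
  have "F s \<le> F t" if "x \<le> s" "s \<le> t" "t \<le> y" for s t
  proof (cases "s = t")
    case False
    have "0 \<le> (t - s) * (F t - F s)"
      using F(2)[OF that] zero_le_power2[of "v t - v s"] by linarith
    then show ?thesis using False that by (simp add: zero_le_mult_iff)
  qed simp
  with F that show thesis by blast
qed

lemma energy_le_nonneg:
  assumes "energy_le v x y e" "x \<le> y" shows "0 \<le> e"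
proof -
  obtain F where "F y - F x \<le> e" "\<And>s t. x \<le> s \<Longrightarrow> s \<le> t \<Longrightarrow> t \<le> y \<Longrightarrow> F s \<le> F t"
    using energy_leE[OF assms(1)] by metis
  from this(1) this(2)[of x y] assms(2) show ?thesis by auto
qed

lemma energy_le_mono: "energy_le v x y e \<Longrightarrow> e \<le> e' \<Longrightarrow> energy_le v x y e'"
  unfolding energy_le_def by (meson order_trans)

lemma energy_le_cong:
  assumes "energy_le v x y e" "\<And>t. x \<le> t \<Longrightarrow> t \<le> y \<Longrightarrow> w t = v t"
  shows "energy_le w x y e"
proof -
  obtain F where F: "F y - F x \<le> e"
    "\<And>s t. x \<le> s \<Longrightarrow> s \<le> t \<Longrightarrow> t \<le> y \<Longrightarrow> (v t - v s)\<^sup>2 \<le> (t - s) * (F t - F s)"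
    using assms(1) unfolding energy_le_def by blast
  show ?thesis
    by (rule energy_leI[of F]) (use F assms(2) in auto)
qed

text \<open>
  The embedding of the energy space into the Hoelder continuous functions of exponent \<open>1/2\<close>; it is
  the source of all compactness below.
\<close>

lemma energy_le_hoelder:
  assumes "energy_le v x y e" "s \<in> {x..y}" "t \<in> {x..y}"
  shows "(v t - v s)\<^sup>2 \<le> \<bar>t - s\<bar> * e"
proof -
  obtain F where F: "F y - F x \<le> e"
    "\<And>s t. x \<le> s \<Longrightarrow> s \<le> t \<Longrightarrow> t \<le> y \<Longrightarrow> (v t - v s)\<^sup>2 \<le> (t - s) * (F t - F s)"
    "\<And>s t. x \<le> s \<Longrightarrow> s \<le> t \<Longrightarrow> t \<le> y \<Longrightarrow> F s \<le> F t"
    using energy_leE[OF assms(1)] by blast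
  have *: "(v t - v s)\<^sup>2 \<le> (t - s) * e" if "x \<le> s" "s \<le> t" "t \<le> y" for s t
  proof -
    have "F t - F s \<le> e" using F(1) F(3)[of x s] F(3)[of t y] that by linarith
    then show ?thesis
      using F(2)[OF that] mult_left_mono[of "F t - F s" e "t - s"] that by linarith
  qed
  show ?thesis
    using *[of s t] *[of t s] assms(2,3) by (cases "s \<le> t") (auto simp: power2_commute)
qed

lemma energy_le_oscillation:
  assumes "energy_le v x y e" "s \<in> {x..y}" "t \<in> {x..y}"
  shows "\<bar>v t - v s\<bar> \<le> sqrt ((y - x) * e)"
proof -
  have "(v t - v s)\<^sup>2 \<le> \<bar>t - s\<bar> * e" by (rule energy_le_hoelder[OF assms])
  also have "\<dots> \<le> (y - x) * e"
    using assms energy_le_nonneg[OF assms(1)] by (intro mult_right_mono) auto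
  finally show ?thesis by (simp add: real_le_rsqrt)
qed

lemma energy_le_continuous_on:
  assumes "energy_le v x y e"
  shows "continuous_on {x..y} v"
proof -
  have "((\<lambda>t. v t) \<longlongrightarrow> v s) (at s within {x..y})" if s: "s \<in> {x..y}" for s
  proof -
    have "((\<lambda>t. v t - v s) \<longlongrightarrow> 0) (at s within {x..y})"
    proof (rule Lim_null_comparison)
      show "\<forall>\<^sub>F t in at s within {x..y}. norm (v t - v s) \<le> sqrt (\<bar>t - s\<bar> * e)"
        unfolding eventually_at_filter
        by (rule always_eventually)
          (auto intro!: real_le_rsqrt energy_le_hoelder[OF assms] simp: s[simplified])
      have "((\<lambda>t. sqrt (\<bar>t - s\<bar> * e)) \<longlongrightarrow> sqrt (\<bar>s - s\<bar> * e)) (at s within {x..y})"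
        by (intro tendsto_intros)
      then show "((\<lambda>t. sqrt (\<bar>t - s\<bar> * e)) \<longlongrightarrow> 0) (at s within {x..y})" by simp
    qed
    then show ?thesis by (simp add: LIM_zero_iff)
  qed
  then show ?thesis by (simp add: continuous_on_def)
qed

lemma square_add_le_of_squares_le:
  fixes X Y s t f g :: real
  assumes "X\<^sup>2 \<le> s * f" "Y\<^sup>2 \<le> t * g" "s \<ge> 0" "t \<ge> 0" "f \<ge> 0" "g \<ge> 0"
  shows "(X + Y)\<^sup>2 \<le> (s + t) * (f + g)"
proof -
  have "(2 * X * Y)\<^sup>2 = 4 * (X\<^sup>2 * Y\<^sup>2)" by (simp add: power2_eq_square)
  also have "\<dots> \<le> 4 * ((s * f) * (t * g))" using assms by (intro mult_left_mono mult_mono) auto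
  also have "\<dots> \<le> (s * g + t * f)\<^sup>2"
    using zero_le_power2[of "s * g - t * f"] by (simp add: power2_eq_square algebra_simps)
  finally have "2 * X * Y \<le> s * g + t * f"
    by (rule power2_le_imp_le) (use assms in auto)
  then show ?thesis using assms(1,2) by (simp add: power2_eq_square algebra_simps)
qed

text \<open>
  Over a pair of points on different sides of \<open>z\<close>, the two Cauchy--Schwarz inequalities combine by
  \<open>(X + Y)\<^sup>2 \<le> (s + t) (f + g)\<close>; so continuous gluing costs nothing beyond the sum of the energies.
\<close>

lemma energy_le_glue:
  assumes "energy_le v x z e" "energy_le v z y e'" "x \<le> z" "z \<le> y"
  shows "energy_le v x y (e + e')"
proof -
  obtain F where F: "F z - F x \<le> e"
    "\<And>s t. x \<le> s \<Longrightarrow> s \<le> t \<Longrightarrow> t \<le> z \<Longrightarrow> (v t - v s)\<^sup>2 \<le> (t - s) * (F t - F s)"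
    "\<And>s t. x \<le> s \<Longrightarrow> s \<le> t \<Longrightarrow> t \<le> z \<Longrightarrow> F s \<le> F t"
    using energy_leE[OF assms(1)] by blast
  obtain G where G: "G y - G z \<le> e'"
    "\<And>s t. z \<le> s \<Longrightarrow> s \<le> t \<Longrightarrow> t \<le> y \<Longrightarrow> (v t - v s)\<^sup>2 \<le> (t - s) * (G t - G s)"
    "\<And>s t. z \<le> s \<Longrightarrow> s \<le> t \<Longrightarrow> t \<le> y \<Longrightarrow> G s \<le> G t"
    using energy_leE[OF assms(2)] by blast
  define H where "H = (\<lambda>t. if t \<le> z then F t - F z else G t - G z)"
  show ?thesis
  proof (rule energy_leI)
    show "H y - H x \<le> e + e'" using F(1) G(1) assms(3,4)
      by (cases "y = z") (simp_all add: H_def)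
    fix s t assume st: "x \<le> s" "s \<le> t" "t \<le> y"
    consider "t \<le> z" | "z < s" | "s \<le> z" "z < t" using st by linarith
    then show "(v t - v s)\<^sup>2 \<le> (t - s) * (H t - H s)"
    proof cases
      case 3
      have "((v z - v s) + (v t - v z))\<^sup>2 \<le> ((z - s) + (t - z)) * ((F z - F s) + (G t - G z))"
        using 3 st F(2)[of s z] F(3)[of s z] G(2)[of z t] G(3)[of z t]
        by (intro square_add_le_of_squares_le) auto
      then show ?thesis using 3 by (simp add: H_def algebra_simps)
    qed (use F(2)[of s t] G(2)[of s t] st in \<open>auto simp: H_def\<close>)
  qed
qed

lemma energy_le_split:
  assumes "energy_le v x y e" "x \<le> z" "z \<le> y"
  obtains e1 e2 where "energy_le v x z e1" "energy_le v z y e2" "e1 + e2 \<le> e"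
proof -
  obtain F where F: "F y - F x \<le> e"
    "\<And>s t. x \<le> s \<Longrightarrow> s \<le> t \<Longrightarrow> t \<le> y \<Longrightarrow> (v t - v s)\<^sup>2 \<le> (t - s) * (F t - F s)"
    using assms(1) unfolding energy_le_def by blast
  have "energy_le v x z (F z - F x)" "energy_le v z y (F y - F z)"
    by (rule energy_leI[of F]; use F(2) assms in force)+
  with F(1) that[of "F z - F x" "F y - F z"] show thesis by simp
qed

text \<open>
  Expanding \<open>\<integral> (v' + \<sigma>)\<^sup>2\<close>, in which the mixed term \<open>2 \<sigma> \<integral> v'\<close> is a boundary term.  This is why
  piecewise affine test functions suffice for the first variation.
\<close>

lemma energy_le_add_affine:
  assumes "energy_le v x y e"
  shows "energy_le (\<lambda>t. v t + (\<sigma> * t + \<kappa>)) x y (e + 2 * \<sigma> * (v y - v x) + \<sigma>\<^sup>2 * (y - x))"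
proof -
  obtain F where F: "F y - F x \<le> e"
    "\<And>s t. x \<le> s \<Longrightarrow> s \<le> t \<Longrightarrow> t \<le> y \<Longrightarrow> (v t - v s)\<^sup>2 \<le> (t - s) * (F t - F s)"
    using assms(1) unfolding energy_le_def by blast
  show ?thesis
  proof (rule energy_leI[where F = "\<lambda>t. F t + 2 * \<sigma> * v t + \<sigma>\<^sup>2 * t"])
    fix s t assume "x \<le> s" "s \<le> t" "t \<le> y"
    from F(2)[OF this]
    show "(v t + (\<sigma> * t + \<kappa>) - (v s + (\<sigma> * s + \<kappa>)))\<^sup>2
        \<le> (t - s) * (F t + 2 * \<sigma> * v t + \<sigma>\<^sup>2 * t - (F s + 2 * \<sigma> * v s + \<sigma>\<^sup>2 * s))"
      by (simp add: power2_eq_square algebra_simps)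
  qed (use F(1) in \<open>simp add: algebra_simps\<close>)
qed

lemma energy_le_affine: "energy_le (\<lambda>t. \<sigma> * t + \<kappa>) x y (\<sigma>\<^sup>2 * (y - x))"
proof -
  have "energy_le (\<lambda>t. 0) x y 0" by (rule energy_leI[of "\<lambda>_. 0"]) auto
  from energy_le_add_affine[OF this, of \<sigma> \<kappa>] show ?thesis by simp
qed

lemma energy_le_scale:
  assumes "energy_le v x y e"
  shows "energy_le (\<lambda>t. c * v t) x y (c\<^sup>2 * e)"
proof -
  obtain F where F: "F y - F x \<le> e"
    "\<And>s t. x \<le> s \<Longrightarrow> s \<le> t \<Longrightarrow> t \<le> y \<Longrightarrow> (v t - v s)\<^sup>2 \<le> (t - s) * (F t - F s)"
    using assms(1) unfolding energy_le_def by blast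
  show ?thesis
  proof (rule energy_leI[where F = "\<lambda>t. c\<^sup>2 * F t"])
    fix s t assume "x \<le> s" "s \<le> t" "t \<le> y"
    from mult_left_mono[OF F(2)[OF this], of "c\<^sup>2"]
    show "(c * v t - c * v s)\<^sup>2 \<le> (t - s) * (c\<^sup>2 * F t - c\<^sup>2 * F s)"
      by (simp add: power2_eq_square algebra_simps)
  qed (use mult_left_mono[OF F(1), of "c\<^sup>2"] in \<open>simp add: algebra_simps\<close>)
qed

lemma energy_le_contraction:
  assumes "energy_le v x y e"
    and "\<And>s t. \<bar>w t - w s\<bar> \<le> \<bar>v t - v s\<bar>"
  shows "energy_le w x y e"
proof -
  have "(w t - w s)\<^sup>2 \<le> (v t - v s)\<^sup>2" for s t
    using assms(2)[of t s] by (simp add: abs_le_square_iff)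
  then show ?thesis using assms(1) unfolding energy_le_def by (meson order_trans)
qed

lemma integral_square_ge:
  fixes v' :: "real \<Rightarrow> real"
  assumes "s \<le> t" and v': "continuous_on {s..t} v'"
    and dv: "\<And>r. r \<in> {s..t} \<Longrightarrow> (v has_real_derivative v' r) (at r within {s..t})"
  shows "(v t - v s)\<^sup>2 \<le> (t - s) * integral {s..t} (\<lambda>r. (v' r)\<^sup>2)"
proof (cases "s = t")
  case False
  define m where "m = (v t - v s) / (t - s)"
  have vm: "v t - v s = (t - s) * m" using False by (simp add: m_def)
  have v: "(v' has_integral (v t - v s)) {s..t}"
    by (rule fundamental_theorem_of_calculus)
      (use assms in \<open>auto simp: has_real_derivative_iff_has_vector_derivative[symmetric]\<close>)
  have i: "((\<lambda>r. (v' r)\<^sup>2) has_integral integral {s..t} (\<lambda>r. (v' r)\<^sup>2)) {s..t}"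
    by (intro integrable_integral integrable_continuous_real continuous_intros v')
  have "((\<lambda>r. (v' r)\<^sup>2 - 2 * m * v' r + m\<^sup>2) has_integral
      (integral {s..t} (\<lambda>r. (v' r)\<^sup>2) - 2 * m * (v t - v s) + (t - s) * m\<^sup>2)) {s..t}"
    using has_integral_add[OF has_integral_diff[OF i has_integral_mult_right[OF v, of "2 * m"]]
        has_integral_const_real[of "m\<^sup>2" s t]] assms(1) by simp
  moreover have "0 \<le> (v' r)\<^sup>2 - 2 * m * v' r + m\<^sup>2" for r
    using zero_le_power2[of "v' r - m"] by (simp add: power2_eq_square algebra_simps)
  ultimately have "0 \<le> integral {s..t} (\<lambda>r. (v' r)\<^sup>2) - 2 * m * (v t - v s) + (t - s) * m\<^sup>2"
    by (rule has_integral_nonneg)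
  also have "\<dots> = integral {s..t} (\<lambda>r. (v' r)\<^sup>2) - (v t - v s)\<^sup>2 / (t - s)"
    using vm False by (simp add: power2_eq_square)
  finally show ?thesis using False assms(1) by (simp add: field_simps)
qed simp

text \<open>
  The integral form of Cauchy--Schwarz links the predicate with the classical energy.
\<close>

lemma energy_le_integral_square:
  fixes v' :: "real \<Rightarrow> real"
  assumes "x \<le> y" and v': "continuous_on UNIV v'"
    and dv: "\<And>r. (v has_real_derivative v' r) (at r)"
  shows "energy_le v x y (integral {x..y} (\<lambda>r. (v' r)\<^sup>2))"
proof (rule energy_leI[where F = "\<lambda>t. integral {x..t} (\<lambda>r. (v' r)\<^sup>2)"])
  have c: "continuous_on S v'" for S using v' continuous_on_subset by blast
  fix s t assume st: "x \<le> s" "s \<le> t" "t \<le> y"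
  have "integral {x..s} (\<lambda>r. (v' r)\<^sup>2) + integral {s..t} (\<lambda>r. (v' r)\<^sup>2)
      = integral {x..t} (\<lambda>r. (v' r)\<^sup>2)"
    by (intro Henstock_Kurzweil_Integration.integral_combine st integrable_continuous_real
        continuous_intros c)
  then have "integral {x..t} (\<lambda>r. (v' r)\<^sup>2) - integral {x..s} (\<lambda>r. (v' r)\<^sup>2)
      = integral {s..t} (\<lambda>r. (v' r)\<^sup>2)"
    by simp
  moreover have "(v t - v s)\<^sup>2 \<le> (t - s) * integral {s..t} (\<lambda>r. (v' r)\<^sup>2)"
    by (rule integral_square_ge[OF st(2) c]) (use dv in \<open>auto intro: has_field_derivative_at_within\<close>)
  ultimately show "(v t - v s)\<^sup>2
      \<le> (t - s) * (integral {x..t} (\<lambda>r. (v' r)\<^sup>2) - integral {x..s} (\<lambda>r. (v' r)\<^sup>2))"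
    by simp
qed simp

text \<open>
  Lower semicontinuity of the energy.  Normalised to vanish at \<open>x\<close>, the accumulated energies
  \<open>F\<^sub>n\<close> stay in \<open>{0..e}\<close>, and since \<open>F\<^sub>n s + (v\<^sub>n t - v\<^sub>n s)\<^sup>2 / (t - s) \<le> F\<^sub>n t\<close>, their pointwise
  lower limit serves for the limit function.
\<close>

lemma energy_le_limit:
  assumes xy: "x \<le> y" and en: "\<And>n. energy_le (v n) x y e"
    and lim: "\<And>t. t \<in> {x..y} \<Longrightarrow> (\<lambda>n. v n t) \<longlonglongrightarrow> w t"
  shows "energy_le w x y e"
proof -
  have "\<exists>F. F x = 0 \<and> F y \<le> e \<and>
      (\<forall>s t. x \<le> s \<and> s \<le> t \<and> t \<le> y \<longrightarrow> (v n t - v n s)\<^sup>2 \<le> (t - s) * (F t - F s)) \<and>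
      (\<forall>t. x \<le> t \<and> t \<le> y \<longrightarrow> 0 \<le> F t \<and> F t \<le> e)" for n
  proof -
    obtain F where F: "F y - F x \<le> e"
    "\<And>s t. x \<le> s \<Longrightarrow> s \<le> t \<Longrightarrow> t \<le> y \<Longrightarrow> (v n t - v n s)\<^sup>2 \<le> (t - s) * (F t - F s)"
    "\<And>s t. x \<le> s \<Longrightarrow> s \<le> t \<Longrightarrow> t \<le> y \<Longrightarrow> F s \<le> F t"
      using energy_leE[OF en, of n] by blast
    have "0 \<le> F t - F x \<and> F t - F x \<le> e" if "x \<le> t" "t \<le> y" for t
      using F(1) F(3)[of x t] F(3)[of t y] that by auto
    then show ?thesis using F by (intro exI[of _ "\<lambda>t. F t - F x"]) auto
  qed
  then obtain F where F0: "\<And>n. F n x = 0" and Fe: "\<And>n. F n y \<le> e"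
    and F: "\<And>n s t. x \<le> s \<Longrightarrow> s \<le> t \<Longrightarrow> t \<le> y \<Longrightarrow> (v n t - v n s)\<^sup>2 \<le> (t - s) * (F n t - F n s)"
    and bd: "\<And>n t. x \<le> t \<Longrightarrow> t \<le> y \<Longrightarrow> 0 \<le> F n t \<and> F n t \<le> e"
    by metis
  define G where "G = (\<lambda>t. real_of_ereal (liminf (\<lambda>n. ereal (F n t))))"
  have G: "ereal (G t) = liminf (\<lambda>n. ereal (F n t))" "G t \<le> e" if "x \<le> t" "t \<le> y" for t
  proof -
    have 1: "0 \<le> liminf (\<lambda>n. ereal (F n t))"
      by (rule Liminf_bounded) (use bd[OF that] in simp)
    have "liminf (\<lambda>n. ereal (F n t)) \<le> limsup (\<lambda>n. ereal (F n t))"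
      by (simp add: Liminf_le_Limsup)
    also have 2: "\<dots> \<le> ereal e" by (rule Limsup_bounded) (use bd[OF that] in simp)
    finally have 2: "liminf (\<lambda>n. ereal (F n t)) \<le> ereal e" .
    show "ereal (G t) = liminf (\<lambda>n. ereal (F n t))"
      using 1 2 unfolding G_def by (cases "liminf (\<lambda>n. ereal (F n t))") auto
    with 2 show "G t \<le> e" by (metis ereal_less_eq(3))
  qed
  show ?thesis
  proof (rule energy_leI[where F = G])
    have "G x = 0" by (simp add: G_def F0 Liminf_const)
    then show "G y - G x \<le> e" using G(2)[of y] xy by simp
    fix s t assume st: "x \<le> s" "s \<le> t" "t \<le> y"
    show "(w t - w s)\<^sup>2 \<le> (t - s) * (G t - G s)"
    proof (cases "s = t")
      case False
      then have d: "0 < t - s" using st by simp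
      have "(\<lambda>n. ereal ((v n t - v n s)\<^sup>2 / (t - s))) \<longlonglongrightarrow> ereal ((w t - w s)\<^sup>2 / (t - s))"
        using lim[of s] lim[of t] st d
        by (intro tendsto_intros) auto
      then have l: "liminf (\<lambda>n. ereal ((v n t - v n s)\<^sup>2 / (t - s))) = ereal ((w t - w s)\<^sup>2 / (t - s))"
        by (rule lim_imp_Liminf[rotated]) simp
      have "ereal ((w t - w s)\<^sup>2 / (t - s)) + ereal (G s)
          = liminf (\<lambda>n. ereal ((v n t - v n s)\<^sup>2 / (t - s))) + liminf (\<lambda>n. ereal (F n s))"
        using l G(1)[of s] st by simp
      also have "\<dots> \<le> liminf (\<lambda>n. ereal ((v n t - v n s)\<^sup>2 / (t - s)) + ereal (F n s))"
        by (rule ereal_liminf_add_mono) (use l G(1)[of s] st in auto)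
      also have "\<dots> \<le> liminf (\<lambda>n. ereal (F n t))"
      proof (rule Liminf_mono, rule always_eventually, rule allI)
        fix n
        have "(v n t - v n s)\<^sup>2 / (t - s) \<le> F n t - F n s"
          using F[OF st, of n] d by (simp add: field_simps)
        then show "ereal ((v n t - v n s)\<^sup>2 / (t - s)) + ereal (F n s) \<le> ereal (F n t)" by simp
      qed
      also have "\<dots> = ereal (G t)" using G(1)[of t] st by simp
      finally have "(w t - w s)\<^sup>2 / (t - s) \<le> G t - G s" by simp
      then show ?thesis using d by (simp add: field_simps)
    qed simp
  qed
qed

section \<open>The weighted power integral\<close>

text \<open>
  The extension of \<open>x\<^sup>r\<close> by zero to negative arguments.  For \<open>r > 1\<close> it is continuously
  differentiable on the whole line, so a maximiser can be varied in both directions even where it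
  might vanish.
\<close>

definition ppow :: "real \<Rightarrow> real \<Rightarrow> real" where
  "ppow r x = max x 0 powr r"

lemma ppow_nonneg [simp]: "0 \<le> ppow r x"
  by (simp add: ppow_def)

lemma ppow_of_nonneg: "0 \<le> x \<Longrightarrow> ppow r x = x powr r"
  by (simp add: ppow_def max_def)

lemma ppow_max_0 [simp]: "ppow r (max x 0) = ppow r x"
  by (simp add: ppow_def)

lemma ppow_mult: "0 \<le> c \<Longrightarrow> ppow r (c * x) = c powr r * ppow r x"
  by (auto simp: ppow_def powr_mult max_def mult_nonneg_nonpos zero_le_mult_iff mult_le_0_iff)

lemma ppow_mono: "0 \<le> r \<Longrightarrow> x \<le> y \<Longrightarrow> ppow r x \<le> ppow r y"
  by (auto simp: ppow_def intro!: powr_mono2)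

lemma continuous_on_ppow [continuous_intros]:
  assumes "continuous_on S f" "0 < r"
  shows "continuous_on S (\<lambda>x. ppow r (f x))"
  unfolding ppow_def
  by (intro continuous_on_powr' continuous_intros assms) (use assms in auto)

lemma has_real_derivative_ppow:
  assumes "1 < r"
  shows "(ppow r has_real_derivative r * ppow (r - 1) x) (at x)"
proof -
  consider "x > 0" | "x < 0" | "x = 0" by linarith
  then show ?thesis
  proof cases
    case 1
    have "((\<lambda>x. x powr r) has_real_derivative r * x powr (r - 1)) (at x)"
      using 1 by (rule has_real_derivative_powr)
    moreover have "\<forall>\<^sub>F y in nhds x. ppow r y = y powr r"
      using eventually_nhds_in_open[of "{0<..}" x] 1
      by (auto elim!: eventually_mono simp: ppow_of_nonneg)
    ultimately show ?thesis
      using 1 by (subst DERIV_cong_ev[where g = "\<lambda>x. x powr r"]) (auto simp: ppow_of_nonneg)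
  next
    case 2
    have "((\<lambda>x. 0) has_real_derivative 0) (at x)" by simp
    moreover have "\<forall>\<^sub>F y in nhds x. ppow r y = 0"
      using eventually_nhds_in_open[of "{..<0}" x] 2
      by (auto elim!: eventually_mono simp: ppow_def max_def)
    ultimately show ?thesis
      using 2 by (subst DERIV_cong_ev[where g = "\<lambda>x. 0"]) (auto simp: ppow_def max_def)
  next
    case 3
    have "((\<lambda>h. ppow r h / h) \<longlongrightarrow> 0) (at 0)"
    proof (rule Lim_null_comparison)
      have "norm (ppow r h / h) \<le> \<bar>h\<bar> powr (r - 1)" if "h \<noteq> 0" for h :: real
      proof (cases "h > 0")
        case True
        then show ?thesis by (simp add: ppow_def powr_diff)
      next
        case False
        then show ?thesis by (simp add: ppow_def max_def)
      qed
      then show "\<forall>\<^sub>F h in at 0. norm (ppow r h / h) \<le> \<bar>h\<bar> powr (r - 1)"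
        by (simp add: eventually_at_filter)
      have "((\<lambda>h::real. \<bar>h\<bar> powr (r - 1)) \<longlongrightarrow> \<bar>0\<bar> powr (r - 1)) (at 0)"
        by (rule tendsto_powr') (use assms tendsto_rabs_zero[OF tendsto_ident_at] in auto)
      then show "((\<lambda>h::real. \<bar>h\<bar> powr (r - 1)) \<longlongrightarrow> 0) (at 0)" by simp
    qed
    then show ?thesis using 3 assms by (simp add: DERIV_def ppow_def)
  qed
qed

text \<open>
  Here \<open>K\<close> bounds \<open>\<integral> \<bar>a\<bar>\<close> and \<open>- A\<close> is the integral of \<open>a\<close>.  With
  \<open>\<theta> = 1 - A / (2 (K + A))\<close> and \<open>\<sigma> = \<theta>\<^bsup>1/q\<^esup>\<close>, values in \<open>[\<sigma> m, m]\<close> have \<open>q\<close>-th powers within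
  \<open>(1 - \<theta>) m\<^sup>q\<close> of \<open>m\<^sup>q\<close>, an error that consumes at most half of the gain \<open>A m\<^sup>q\<close>.
\<close>

definition oscillation_const :: "real \<Rightarrow> real \<Rightarrow> real \<Rightarrow> real" where
  "oscillation_const K A q =
     (K + A / 2) * (1 / (1 - (1 - A / (2 * (K + A))) powr (1 / q))) powr q"

lemma oscillation_const_nonneg: "0 \<le> K \<Longrightarrow> 0 < A \<Longrightarrow> 0 \<le> oscillation_const K A q"
  by (simp add: oscillation_const_def)

text \<open>
  This is the quantitative use of the negative mean.  Let \<open>m\<close> be the maximum of \<open>v\<close>.  If the
  oscillation is small compared with \<open>m\<close>, then \<open>v\<^sup>q\<close> is nearly constant and the integral is at most
  \<open>- A m\<^sup>q / 2\<close>; otherwise \<open>m\<close> is bounded by a multiple of \<open>\<omega>\<close>, and so is everything else.  The term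
  with \<open>v r\<close> is what bounds maximising sequences and, later, makes most cells small.
\<close>

lemma weighted_power_integral_le:
  fixes a v :: "real \<Rightarrow> real" and K A B q x y \<omega> r :: real
  assumes A0: "0 < A" and q0: "0 < q" and xy: "x < y"
    and a: "continuous_on {x..y} a" and v: "continuous_on {x..y} v"
    and B: "\<And>t. t \<in> {x..y} \<Longrightarrow> \<bar>a t\<bar> \<le> B" and K: "B * (y - x) \<le> K"
    and A: "integral {x..y} a = - A"
    and v0: "\<And>t. t \<in> {x..y} \<Longrightarrow> 0 \<le> v t" and \<omega>: "0 \<le> \<omega>"
    and osc: "\<And>s t. s \<in> {x..y} \<Longrightarrow> t \<in> {x..y} \<Longrightarrow> v t - v s \<le> \<omega>"
    and r: "r \<in> {x..y}"
  shows "integral {x..y} (\<lambda>t. a t * ppow q (v t))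
    \<le> oscillation_const K A q * \<omega> powr q - A / 2 * v r powr q"
proof -
  define C where "C = oscillation_const K A q"
  have B0: "0 \<le> B" using B[of x] xy by auto
  then have K0: "0 \<le> K" using K xy mult_nonneg_nonneg[of B "y - x"] by linarith
  define \<theta> where "\<theta> = 1 - A / (2 * (K + A))"
  define \<sigma> where "\<sigma> = \<theta> powr (1 / q)"
  have \<theta>: "0 < \<theta>" "\<theta> < 1" "K * (1 - \<theta>) \<le> A / 2"
    using A0 q0 K0 by (auto simp: \<theta>_def field_simps)
  have \<sigma>: "0 < \<sigma>" "\<sigma> < 1" "\<sigma> powr q = \<theta>"
    using \<theta> q0 powr_less_mono2[of "1 / q" \<theta> 1] by (auto simp: \<sigma>_def powr_powr)
  have C: "C = (K + A / 2) * (1 / (1 - \<sigma>)) powr q"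
    by (simp add: C_def oscillation_const_def \<sigma>_def \<theta>_def)
  have C0: "0 \<le> C" using A0 K0 by (simp add: C)
  obtain z where z: "z \<in> {x..y}" "\<And>t. t \<in> {x..y} \<Longrightarrow> v t \<le> v z"
    using continuous_attains_sup[OF compact_Icc _ v] xy by auto
  define m where "m = v z"
  have m: "0 \<le> m" "v r powr q \<le> m powr q"
    using z r v0 A0 q0 by (auto simp: m_def intro!: powr_mono2)
  have cv: "continuous_on {x..y} (\<lambda>t. a t * ppow q (v t))"
    by (intro continuous_intros a v q0)
  have mv: "A / 2 * v r powr q \<le> A / 2 * m powr q"
    using m A0 by (intro mult_left_mono) auto
  show ?thesis
  proof (cases "m - \<omega> \<ge> \<sigma> * m")
    case True
    have "norm (a t * (ppow q (v t) - m powr q)) \<le> B * ((1 - \<theta>) * m powr q)" if t: "t \<in> {x..y}" for t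
    proof -
      have "\<sigma> * m \<le> v t" using True osc[of t z] t z by (simp add: m_def)
      then have "(\<sigma> * m) powr q \<le> v t powr q"
        using \<sigma> m A0 q0 by (intro powr_mono2) auto
      moreover have "v t powr q \<le> m powr q"
        using z t v0 A0 q0 by (auto simp: m_def intro!: powr_mono2)
      ultimately have "\<bar>v t powr q - m powr q\<bar> \<le> (1 - \<theta>) * m powr q"
        using \<sigma> m by (simp add: powr_mult algebra_simps)
      then show ?thesis
        using B[OF t] v0[OF t] B0 by (auto simp: abs_mult ppow_of_nonneg intro!: mult_mono)
    qed
    then have "norm (integral {x..y} (\<lambda>t. a t * (ppow q (v t) - m powr q)))
        \<le> B * ((1 - \<theta>) * m powr q) * (y - x)"
      by (intro integral_bound continuous_intros a v q0) (use xy in auto)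
    also have "\<dots> = (B * (y - x)) * ((1 - \<theta>) * m powr q)" by simp
    also have "\<dots> \<le> K * ((1 - \<theta>) * m powr q)"
      using K \<theta> by (intro mult_right_mono) auto
    also have "\<dots> \<le> A / 2 * m powr q"
      using mult_right_mono[OF \<theta>(3), of "m powr q"] by (simp add: mult.assoc)
    finally have 1: "integral {x..y} (\<lambda>t. a t * (ppow q (v t) - m powr q)) \<le> A / 2 * m powr q"
      by simp
    have "integral {x..y} (\<lambda>t. a t * (ppow q (v t) - m powr q))
        = integral {x..y} (\<lambda>t. a t * ppow q (v t) - a t * m powr q)"
      by (simp add: algebra_simps)
    also have "\<dots> = integral {x..y} (\<lambda>t. a t * ppow q (v t)) - integral {x..y} (\<lambda>t. a t * m powr q)"
      by (intro Henstock_Kurzweil_Integration.integral_diff integrable_continuous_real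
          continuous_intros a v q0)
    also have "\<dots> = integral {x..y} (\<lambda>t. a t * ppow q (v t)) + A * m powr q"
      by (simp add: A)
    finally have "integral {x..y} (\<lambda>t. a t * ppow q (v t)) \<le> - (A / 2 * m powr q)"
      using 1 by (simp add: field_simps)
    also have "\<dots> \<le> C * \<omega> powr q - A / 2 * v r powr q"
      using mv mult_nonneg_nonneg[OF C0, of "\<omega> powr q"] by simp
    finally show ?thesis by (simp add: C_def)
  next
    case False
    then have "m \<le> \<omega> / (1 - \<sigma>)" using \<sigma> by (simp add: field_simps)
    then have "m powr q \<le> (\<omega> / (1 - \<sigma>)) powr q" using m A0 q0 by (intro powr_mono2) auto
    also have "\<dots> = (1 / (1 - \<sigma>)) powr q * \<omega> powr q"
      using \<sigma> \<omega> by (simp add: powr_divide)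
    finally have 2: "(K + A / 2) * m powr q \<le> C * \<omega> powr q"
      using A0 K0 mult_left_mono[of "m powr q" _ "K + A / 2"] by (simp add: C mult.assoc)
    have "norm (integral {x..y} (\<lambda>t. a t * ppow q (v t))) \<le> B * m powr q * (y - x)"
    proof (rule integral_bound[OF _ cv])
      show "norm (a t * ppow q (v t)) \<le> B * m powr q" if "t \<in> {x..y}" for t
        using that B v0 z A0 q0 B0
        by (auto simp: abs_mult ppow_of_nonneg m_def intro!: mult_mono powr_mono2)
    qed (use xy in auto)
    also have "\<dots> = (B * (y - x)) * m powr q" by simp
    also have "\<dots> \<le> K * m powr q" using K by (intro mult_right_mono) auto
    finally have "integral {x..y} (\<lambda>t. a t * ppow q (v t)) \<le> K * m powr q" by simp
    then show ?thesis
      using 2 mv by (simp add: C_def algebra_simps)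
  qed
qed

section \<open>Existence of a maximiser\<close>

text \<open>
  The direct method.  The oscillation of an admissible function is at most \<open>sqrt L\<close>, so the preceding
  estimate bounds \<open>J\<close> from above and bounds every function with \<open>J > 0\<close>; Hoelder continuity gives
  equicontinuity, and the constraint survives the limit.  The last property extends maximality to all
  functions: negative parts do not contribute to \<open>J\<close>, and \<open>J\<close> is homogeneous of degree \<open>q\<close> while
  the energy is homogeneous of degree \<open>2\<close>.
\<close>

lemma constrained_maximiser_exists:
  fixes a :: "real \<Rightarrow> real" and L q :: real
  assumes L: "0 < L" and q: "0 < q" and a: "continuous_on {0..L} a"
    and neg: "integral {0..L} a < 0"
    and v0: "v0 0 = v0 L" "energy_le v0 0 L e0" "0 < integral {0..L} (\<lambda>t. a t * ppow q (v0 t))"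
  obtains u M where "0 < M" "u 0 = u L" "\<And>t. t \<in> {0..L} \<Longrightarrow> 0 \<le> u t" "energy_le u 0 L 1"
    "integral {0..L} (\<lambda>t. a t * ppow q (u t)) = M"
    "\<And>v e. v 0 = v L \<Longrightarrow> energy_le v 0 L e \<Longrightarrow> 0 < e
      \<Longrightarrow> integral {0..L} (\<lambda>t. a t * ppow q (v t)) \<le> M * e powr (q / 2)"
proof -
  define J where "J = (\<lambda>v. integral {0..L} (\<lambda>t. a t * ppow q (v t)))"
  define adm where "adm = (\<lambda>v. v 0 = v L \<and> (\<forall>t\<in>{0..L}. 0 \<le> v t) \<and> energy_le v 0 L 1)"
  define A where "A = - integral {0..L} a"
  have A: "0 < A" using neg by (simp add: A_def)
  obtain B where B: "\<And>t. t \<in> {0..L} \<Longrightarrow> \<bar>a t\<bar> \<le> B"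
    using compact_imp_bounded[OF compact_continuous_image[OF a compact_Icc]]
    unfolding bounded_iff by (metis imageI real_norm_def)
  have B0: "0 \<le> B" using B[of 0] L by auto
  define D where "D = oscillation_const (B * L) A q * sqrt L powr q"
  have D: "J v \<le> D - A / 2 * v r powr q" if "adm v" "r \<in> {0..L}" for v r
  proof -
    have e: "energy_le v 0 L 1" and v: "\<And>t. t \<in> {0..L} \<Longrightarrow> 0 \<le> v t"
      using that by (auto simp: adm_def)
    show ?thesis
      unfolding J_def D_def
    proof (rule weighted_power_integral_le[where B = B])
      fix s t assume "s \<in> {0..L}" "t \<in> {0..L}"
      then show "v t - v s \<le> sqrt L" using energy_le_oscillation[OF e] by fastforce
    qed (use L a energy_le_continuous_on[OF e] A q B v that in \<open>auto simp: A_def\<close>)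
  qed
  have scale: "J v \<le> Sup (J ` Collect adm) * e powr (q / 2)"
    if v: "v 0 = v L" "energy_le v 0 L e" "0 < e" for v e
  proof -
    \<comment> \<open>the positive part, normalised to energy 1\<close>
    define w where "w = (\<lambda>t. (1 / sqrt e) * max (v t) 0)"
    have "energy_le (\<lambda>t. max (v t) 0) 0 L e"
      by (rule energy_le_contraction[OF v(2)]) (auto simp: max_def)
    from energy_le_scale[OF this, of "1 / sqrt e"]
    have "energy_le w 0 L 1" using v(3) by (simp add: w_def power_divide)
    then have "adm w" using v by (auto simp: adm_def w_def)
    moreover have "bdd_above (J ` Collect adm)"
    proof (rule bdd_aboveI2)
      fix v assume "v \<in> Collect adm"
      then have "J v \<le> D - A / 2 * v 0 powr q" using D[of v 0] L by simp
      also have "\<dots> \<le> D" using A by simp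
      finally show "J v \<le> D" .
    qed
    ultimately have "J w \<le> Sup (J ` Collect adm)" by (intro cSup_upper) auto
    moreover have "J w = (1 / sqrt e) powr q * J v"
    proof -
      have "(\<lambda>t. a t * ppow q (w t)) = (\<lambda>t. (1 / sqrt e) powr q * (a t * ppow q (v t)))"
        using v(3) by (simp add: w_def ppow_mult mult.left_commute del: times_divide_eq_left)
      then show ?thesis by (simp only: J_def integral_mult_right)
    qed
    moreover have "(1 / sqrt e) powr q * e powr (q / 2) = 1"
      using v(3) by (simp add: powr_divide powr_half_sqrt[symmetric] powr_powr)
    ultimately have "(1 / sqrt e) powr q * J v * e powr (q / 2)
        \<le> Sup (J ` Collect adm) * e powr (q / 2)"
      by (intro mult_right_mono) auto
    moreover have "(1 / sqrt e) powr q * J v * e powr (q / 2) = J v"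
      using \<open>(1 / sqrt e) powr q * e powr (q / 2) = 1\<close> by (metis mult.assoc mult.commute mult_1)
    ultimately show ?thesis by simp
  qed
  define M where "M = Sup (J ` Collect adm)"
  have "0 < J v0" using v0(3) by (simp add: J_def)
  also have "J v0 \<le> M * (max e0 1) powr (q / 2)"
    unfolding M_def by (rule scale) (use v0 in \<open>auto intro: energy_le_mono\<close>)
  finally have M: "0 < M" by (simp add: zero_less_mult_iff)
  \<comment> \<open>the shift by 2 keeps \<open>J\<close> positive along the maximising sequence, hence the sequence bounded\<close>
  have "\<exists>v. adm v \<and> M * (1 - 1 / real (n + 2)) < J v" for n
  proof -
    have "adm (\<lambda>_. 0)" using energy_le_affine[of 0 0 0 L] by (auto simp: adm_def intro: energy_le_mono)
    then have "J ` Collect adm \<noteq> {}" by auto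
    moreover have "M * (1 - 1 / real (n + 2)) < Sup (J ` Collect adm)"
      using M unfolding M_def[symmetric] by (simp add: field_simps)
    ultimately obtain j where "j \<in> J ` Collect adm" "M * (1 - 1 / real (n + 2)) < j"
      by (auto elim: less_cSupE)
    then show ?thesis by auto
  qed
  then have "\<exists>V. \<forall>n. adm (V n) \<and> M * (1 - 1 / real (n + 2)) < J (V n)"
    by (intro choice allI)
  then obtain V where V: "\<And>n. adm (V n)" "\<And>n. M * (1 - 1 / real (n + 2)) < J (V n)"
    by blast
  have V_pos: "0 < J (V n)" for n
  proof -
    have "0 \<le> M * (1 - 1 / real (n + 2))" using M by simp
    then show ?thesis using V(2)[of n] by linarith
  qed
  have V_bd: "norm (V n r) \<le> (2 * D / A) powr (1 / q)" if "r \<in> {0..L}" for n r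
  proof -
    have "A / 2 * V n r powr q \<le> D" using D[OF V(1) that, of n] V_pos[of n] by simp
    then have "V n r powr q \<le> 2 * D / A" using A by (simp add: field_simps)
    then have "(V n r powr q) powr (1 / q) \<le> (2 * D / A) powr (1 / q)"
      using q by (intro powr_mono2) auto
    moreover have "0 \<le> V n r" using V(1)[of n] that by (auto simp: adm_def)
    ultimately show ?thesis using q by (simp add: powr_powr)
  qed
  have V_en: "energy_le (V n) 0 L 1" for n using V(1)[of n] by (simp add: adm_def)
  have V_eq: "\<exists>d. 0 < d \<and> (\<forall>n y. y \<in> {0..L} \<and> norm (x - y) < d \<longrightarrow> norm (V n x - V n y) < e)"
    if "x \<in> {0..L}" "0 < e" for x e
  proof (intro exI[of _ "e\<^sup>2"] conjI allI impI)
    fix n y assume y: "y \<in> {0..L} \<and> norm (x - y) < e\<^sup>2"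
    have "(V n x - V n y)\<^sup>2 < e\<^sup>2"
      using energy_le_hoelder[OF V_en, of y x n] y that by simp
    then show "norm (V n x - V n y) < e" using that power2_less_imp_less[of "\<bar>V n x - V n y\<bar>" e] by simp
  qed (use that in auto)
  obtain u k where k: "strict_mono (k :: nat \<Rightarrow> nat)"
    and lim: "\<And>e. 0 < e \<Longrightarrow> \<exists>N. \<forall>n x. n \<ge> N \<and> x \<in> {0..L} \<longrightarrow> norm (V (k n) x - u x) < e"
    using Arzela_Ascoli[of "{0..L}" V, OF compact_Icc V_bd V_eq] by metis
  have lim: "(\<lambda>n. V (k n) t) \<longlonglongrightarrow> u t" if "t \<in> {0..L}" for t
    using lim that by (force simp: LIMSEQ_iff)
  have u_en: "energy_le u 0 L 1" by (rule energy_le_limit[OF less_imp_le[OF L] V_en lim])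
  have u_nonneg: "0 \<le> u t" if "t \<in> {0..L}" for t
    by (rule LIMSEQ_le_const[OF lim[OF that]]) (use V(1) that in \<open>auto simp: adm_def\<close>)
  have u_per: "u 0 = u L"
  proof (rule LIMSEQ_unique)
    show "(\<lambda>n. V (k n) 0) \<longlonglongrightarrow> u 0" using lim L by auto
    have "V (k n) 0 = V (k n) L" for n using V(1)[of "k n"] by (simp add: adm_def)
    then show "(\<lambda>n. V (k n) 0) \<longlonglongrightarrow> u L" using lim[of L] L by simp
  qed
  have "(\<lambda>n. J (V (k n))) \<longlonglongrightarrow> J u"
    unfolding J_def
  proof (rule dominated_convergence(2)[where h = "\<lambda>_. B * ((2 * D / A) powr (1 / q)) powr q"])
    show "(\<lambda>t. a t * ppow q (V (k n) t)) integrable_on {0..L}" for n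
      by (intro integrable_continuous_real continuous_intros a energy_le_continuous_on[OF V_en] q)
    show "norm (a t * ppow q (V (k n) t)) \<le> B * ((2 * D / A) powr (1 / q)) powr q"
      if "t \<in> {0..L}" for n t
    proof -
      have "0 \<le> V (k n) t" using V(1)[of "k n"] that by (auto simp: adm_def)
      then have "ppow q (V (k n) t) \<le> ((2 * D / A) powr (1 / q)) powr q"
        using V_bd[OF that, of "k n"] q unfolding ppow_def by (intro powr_mono2) auto
      then show ?thesis using B[OF that] B0 by (simp add: abs_mult mult_mono)
    qed
    show "(\<lambda>n. a t * ppow q (V (k n) t)) \<longlonglongrightarrow> a t * ppow q (u t)" if "t \<in> {0..L}" for t
      using that q unfolding ppow_def by (intro tendsto_intros lim tendsto_powr') auto
  qed auto
  moreover have "(\<lambda>n. J (V (k n))) \<longlonglongrightarrow> M"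
  proof (rule tendsto_sandwich[where f = "\<lambda>n. M * (1 - 1 / real (k n + 2))" and h = "\<lambda>_. M"])
    have "(\<lambda>n. M * (1 - 1 / real (n + 2))) \<longlonglongrightarrow> M" by real_asymp
    from LIMSEQ_subseq_LIMSEQ[OF this k]
    show "(\<lambda>n. M * (1 - 1 / real (k n + 2))) \<longlonglongrightarrow> M" by (simp add: o_def)
    have "J (V (k n)) \<le> M" for n
      using scale[of "V (k n)" 1] V(1)[of "k n"] by (simp add: adm_def M_def)
    then show "\<forall>\<^sub>F n in sequentially. J (V (k n)) \<le> M" by simp
    show "\<forall>\<^sub>F n in sequentially. M * (1 - 1 / real (k n + 2)) \<le> J (V (k n))"
      using V(2) by (simp add: less_imp_le)
  qed simp
  ultimately have "J u = M" by (rule LIMSEQ_unique)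
  with M u_per u_nonneg u_en scale show thesis
    by (intro that[of M u]) (simp_all add: J_def M_def)
qed

section \<open>First variation\<close>

lemma has_real_derivative_power_functional:
  fixes a u \<phi> :: "real \<Rightarrow> real" and L q :: real
  assumes q: "1 < q" and a: "continuous_on {0..L} a" and u: "continuous_on {0..L} u"
    and \<phi>: "continuous_on {0..L} \<phi>"
  shows "((\<lambda>s. integral {0..L} (\<lambda>t. a t * ppow q (u t + s * \<phi> t))) has_real_derivative
    q * integral {0..L} (\<lambda>t. a t * ppow (q - 1) (u t) * \<phi> t)) (at 0)"
proof -
  have "((\<lambda>s. integral (cbox 0 L) (\<lambda>t. a t * ppow q (u t + s * \<phi> t))) has_real_derivative
    integral (cbox 0 L) (\<lambda>t. a t * (q * ppow (q - 1) (u t + 0 * \<phi> t) * \<phi> t))) (at 0 within UNIV)"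
  proof (rule leibniz_rule_field_derivative)
    fix s t :: real
    show "((\<lambda>s. a t * ppow q (u t + s * \<phi> t)) has_real_derivative
        a t * (q * ppow (q - 1) (u t + s * \<phi> t) * \<phi> t)) (at s within UNIV)"
      by (auto intro!: derivative_eq_intros DERIV_chain2[OF has_real_derivative_ppow[OF q]])
    show "(\<lambda>t. a t * ppow q (u t + s * \<phi> t)) integrable_on cbox 0 L"
      using q by (auto intro!: integrable_continuous_real continuous_intros a u \<phi>)
  next
    have snd: "continuous_on (UNIV \<times> cbox 0 L) (\<lambda>z::real \<times> real. f (snd z))"
      if "continuous_on {0..L} f" for f :: "real \<Rightarrow> real"
      by (rule continuous_on_compose2[OF that]) (auto intro: continuous_intros)
    show "continuous_on (UNIV \<times> cbox 0 L)
        (\<lambda>(s, t). a t * (q * ppow (q - 1) (u t + s * \<phi> t) * \<phi> t))"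
      unfolding case_prod_unfold
      by (intro continuous_intros snd a u \<phi>) (use q in auto)
  qed auto
  then show ?thesis by (simp add: algebra_simps flip: integral_mult_right)
qed

text \<open>
  The number \<open>b\<close> stands for \<open>\<integral> u' \<phi>'\<close> and \<open>c\<close> for \<open>\<integral> \<phi>'\<^sup>2\<close>.  The function
  \<open>M (1 + 2 s b + s\<^sup>2 c)\<^bsup>q/2\<^esup> - J (u + s \<phi>)\<close> of \<open>s\<close> is nonnegative by maximality and vanishes at \<open>0\<close>;
  its derivative there must be zero, which is the weak form of the Euler--Lagrange equation.
\<close>

lemma critical_point_identity:
  fixes a u \<phi> :: "real \<Rightarrow> real" and L q M b c :: real
  assumes q: "1 < q" and a: "continuous_on {0..L} a"
    and u: "u 0 = u L" "continuous_on {0..L} u"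
    and M: "integral {0..L} (\<lambda>t. a t * ppow q (u t)) = M"
    and max: "\<And>v e. v 0 = v L \<Longrightarrow> energy_le v 0 L e \<Longrightarrow> 0 < e
      \<Longrightarrow> integral {0..L} (\<lambda>t. a t * ppow q (v t)) \<le> M * e powr (q / 2)"
    and \<phi>: "\<phi> 0 = \<phi> L" "continuous_on {0..L} \<phi>" and c: "0 \<le> c"
    and en: "\<And>s. energy_le (\<lambda>t. u t + s * \<phi> t) 0 L (1 + 2 * s * b + s\<^sup>2 * c)"
  shows "integral {0..L} (\<lambda>t. a t * ppow (q - 1) (u t) * \<phi> t) = M * b"
proof -
  define H where "H = (\<lambda>s. M * (1 + 2 * s * b + s\<^sup>2 * c) powr (q / 2)
    - integral {0..L} (\<lambda>t. a t * ppow q (u t + s * \<phi> t)))"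
  define I where "I = integral {0..L} (\<lambda>t. a t * ppow (q - 1) (u t) * \<phi> t)"
  have "((\<lambda>s. (1 + 2 * s * b + s\<^sup>2 * c) powr (q / 2)) has_real_derivative
      (q / 2) * (1 + 2 * 0 * b + 0\<^sup>2 * c) powr (q / 2 - 1) * (2 * b)) (at 0)"
    by (rule DERIV_chain2[OF has_real_derivative_powr]) (auto intro!: derivative_eq_intros)
  then have "(H has_real_derivative M * (q * b) - q * I) (at 0)"
    unfolding H_def I_def
    by (intro DERIV_diff DERIV_cmult has_real_derivative_power_functional q a u \<phi>) simp
  moreover have "\<forall>s. \<bar>0 - s\<bar> < 1 / (2 * \<bar>b\<bar> + 1) \<longrightarrow> H 0 \<le> H s"
  proof (intro allI impI)
    fix s assume "\<bar>0 - s\<bar> < 1 / (2 * \<bar>b\<bar> + 1)"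
    then have "\<bar>s\<bar> * (2 * \<bar>b\<bar> + 1) < 1" by (simp add: field_simps)
    then have "\<bar>2 * s * b\<bar> < 1" by (simp add: abs_mult algebra_simps)
    then have "0 < 1 + 2 * s * b" by linarith
    moreover have "0 \<le> s\<^sup>2 * c" using c by simp
    ultimately have "0 < 1 + 2 * s * b + s\<^sup>2 * c" by linarith
    then have "0 \<le> H s" using max[OF _ en, of s] u \<phi> by (simp add: H_def)
    moreover have "H 0 = 0" using M by (simp add: H_def)
    ultimately show "H 0 \<le> H s" by simp
  qed
  ultimately have "M * (q * b) - q * I = 0"
    by (intro DERIV_local_min[of H _ 0 "1 / (2 * \<bar>b\<bar> + 1)"]) auto
  then have "q * (M * b - I) = 0" by (simp add: algebra_simps)
  then show ?thesis using q by (simp add: I_def)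
qed

section \<open>Periodic functions\<close>

lemma periodic_reduce:
  fixes t L :: real
  assumes "0 < L"
  obtains s n where "s \<in> {0..<L}" "t = s + of_int n * L"
proof -
  define s where "s = t - of_int \<lfloor>t / L\<rfloor> * L"
  have "of_int \<lfloor>t / L\<rfloor> \<le> t / L" "t / L < of_int \<lfloor>t / L\<rfloor> + 1" by linarith+
  then have "of_int \<lfloor>t / L\<rfloor> * L \<le> t" "t < (of_int \<lfloor>t / L\<rfloor> + 1) * L"
    using assms by (simp_all only: pos_le_divide_eq pos_divide_less_eq)
  then have "s \<in> {0..<L}" by (simp add: s_def algebra_simps)
  then show thesis using that[of s "\<lfloor>t / L\<rfloor>"] by (simp add: s_def)
qed

lemma periodic_add_of_int:
  fixes f :: "real \<Rightarrow> 'b"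
  assumes "\<And>t. f (t + L) = f t"
  shows "f (t + of_int n * L) = f t"
proof -
  interpret periodic_fun_simple f L by standard (rule assms)
  show ?thesis by (rule plus_of_int)
qed

lemma periodic_eqI:
  fixes f g :: "real \<Rightarrow> 'b"
  assumes "0 < L" "\<And>t. f (t + L) = f t" "\<And>t. g (t + L) = g t"
    and "\<And>t. t \<in> {0..<L} \<Longrightarrow> f t = g t"
  shows "f t = g t"
proof -
  obtain s n where "s \<in> {0..<L}" "t = s + of_int n * L" by (rule periodic_reduce[OF assms(1)])
  then show ?thesis
    using assms(4) periodic_add_of_int[of f L, OF assms(2)] periodic_add_of_int[of g L, OF assms(3)]
    by simp
qed

lemma periodic_bounded:
  fixes f :: "real \<Rightarrow> real"
  assumes "0 < L" "\<And>t. f (t + L) = f t" "continuous_on UNIV f"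
  obtains B where "0 < B" "\<And>t. \<bar>f t\<bar> \<le> B"
proof -
  have "compact (f ` {0..L})"
    by (intro compact_continuous_image continuous_on_subset[OF assms(3)]) auto
  then obtain B where B: "\<And>t. t \<in> {0..L} \<Longrightarrow> \<bar>f t\<bar> \<le> B"
    using compact_imp_bounded bounded_iff by (metis imageI real_norm_def)
  have "\<bar>f t\<bar> \<le> max B 1" for t
  proof -
    obtain s n where "s \<in> {0..<L}" "t = s + of_int n * L" by (rule periodic_reduce[OF assms(1)])
    then have "\<bar>f t\<bar> \<le> B" using B[of s] periodic_add_of_int[of f L s n, OF assms(2)] by simp
    then show ?thesis by simp
  qed
  then show thesis using that[of "max B 1"] by auto
qed

lemma periodic_extension:
  fixes f :: "real \<Rightarrow> real"
  assumes L: "0 < L" and f: "continuous_on {0..L} f" "f 0 = f L"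
  obtains g where "continuous_on UNIV g" "\<And>t. g (t + L) = g t" "\<And>t. t \<in> {0..L} \<Longrightarrow> g t = f t"
proof -
  define g where "g = (\<lambda>t. f (L * frac (t / L)))"
  have per: "g (t + L) = g t" for t
  proof -
    have "(t + L) / L = t / L + 1" using L by (simp add: add_divide_distrib)
    then show ?thesis by (simp add: g_def frac_1_eq)
  qed
  have eq: "g t = f t" if t: "t \<in> {0..L}" for t
  proof (cases "t = L")
    case False
    then have "frac (t / L) = t / L" using t L by (simp add: frac_eq)
    then show ?thesis using L by (simp add: g_def)
  qed (use L f(2) in \<open>simp add: g_def\<close>)
  have "isCont g t" for t
  proof -
    obtain s n where s: "s \<in> {0..<L}" and t: "t = s + of_int n * L"
      by (rule periodic_reduce[OF L])
    have piece: "continuous_on {of_int m * L .. of_int m * L + L} g" for m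
    proof -
      have "continuous_on {of_int m * L .. of_int m * L + L} (\<lambda>x. f (x - of_int m * L))"
        by (rule continuous_on_compose2[OF f(1)]) (auto intro!: continuous_intros)
      moreover have "g x = f (x - of_int m * L)" if "x \<in> {of_int m * L .. of_int m * L + L}" for x
        using eq[of "x - of_int m * L"] that periodic_add_of_int[of g L "x - of_int m * L" m, OF per]
        by simp
      ultimately show ?thesis by (subst continuous_on_cong[OF refl]) auto
    qed
    \<comment> \<open>two adjacent periods, so that \<open>t\<close> is an interior point even when it is a multiple of \<open>L\<close>\<close>
    have "continuous_on ({of_int (n - 1) * L .. of_int (n - 1) * L + L} \<union>
        {of_int n * L .. of_int n * L + L}) g"
      by (intro continuous_on_closed_Un piece) auto
    also have "{of_int (n - 1) * L .. of_int (n - 1) * L + L} \<union> {of_int n * L .. of_int n * L + L}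
        = {of_int (n - 1) * L .. of_int n * L + L}"
      using L by (subst ivl_disj_un_two_touch(4)[symmetric, of _ "of_int n * L"])
        (auto simp: algebra_simps)
    finally show ?thesis
      by (rule continuous_on_interior) (use s t L in \<open>auto simp: algebra_simps\<close>)
  qed
  then show thesis using that[of g] per eq by (simp add: continuous_at_imp_continuous_on)
qed

lemma continuous_antiderivative:
  fixes g :: "real \<Rightarrow> real"
  assumes "continuous_on UNIV g"
  obtains G where "\<And>t. (G has_real_derivative g t) (at t)"
proof -
  have "isCont g t" for t using assms by (simp add: continuous_on_eq_continuous_at)
  then show thesis
    using einterval_antiderivative[of "-\<infinity>" \<infinity> g] that
    by (auto simp: has_real_derivative_iff_has_vector_derivative)
qed

lemma periodic_antiderivative:
  fixes G g :: "real \<Rightarrow> real"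
  assumes "\<And>t. (G has_real_derivative g t) (at t)" "\<And>t. g (t + L) = g t" "G L = G 0"
  shows "G (t + L) = G t"
proof -
  have "((\<lambda>t. G (t + L) - G t) has_real_derivative 0) (at t)" for t
    using DERIV_diff[OF DERIV_shift[THEN iffD1, OF assms(1)[of "t + L"]] assms(1)[of t]] assms(2)
    by simp
  then have "G (t + L) - G t = G (0 + L) - G 0" by (intro DERIV_const_ratio_const DERIV_isconst_all) auto
  then show ?thesis using assms(3) by simp
qed

section \<open>Uniqueness at a zero\<close>

text \<open>
  A Gronwall argument: \<open>(u\<^sup>2 + u'\<^sup>2) exp (- (1 + K) t)\<close> is decreasing, since
  \<open>2 u u' + 2 u' u'' \<le> (1 + K) 2 \<bar>u\<bar> \<bar>u'\<bar> \<le> (1 + K) (u\<^sup>2 + u'\<^sup>2)\<close>.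
\<close>

lemma eq_zero_of_linear_differential_inequality:
  fixes u u' u'' :: "real \<Rightarrow> real"
  assumes u: "\<And>t. (u has_real_derivative u' t) (at t)" "\<And>t. (u' has_real_derivative u'' t) (at t)"
    and K: "0 \<le> K" "\<And>t. \<bar>u'' t\<bar> \<le> K * \<bar>u t\<bar>" and zero: "u r = 0" "u' r = 0" and t: "r \<le> t"
  shows "u t = 0"
proof -
  define y where "y = (\<lambda>t. ((u t)\<^sup>2 + (u' t)\<^sup>2) * exp (- (1 + K) * t))"
  have "y t \<le> y r"
  proof (rule DERIV_nonpos_imp_nonincreasing[OF t])
    fix s
    have dy: "(y has_real_derivative
        (2 * u s * u' s + 2 * u' s * u'' s - (1 + K) * ((u s)\<^sup>2 + (u' s)\<^sup>2)) * exp (- (1 + K) * s)) (at s)"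
      unfolding y_def
      by (auto intro!: derivative_eq_intros u simp: algebra_simps)
    have "2 * u s * u' s + 2 * u' s * u'' s \<le> 2 * \<bar>u s\<bar> * \<bar>u' s\<bar> + 2 * \<bar>u' s\<bar> * \<bar>u'' s\<bar>"
      using abs_ge_self[of "2 * u s * u' s"] abs_ge_self[of "2 * u' s * u'' s"]
      by (simp add: abs_mult)
    also have "\<dots> \<le> 2 * \<bar>u s\<bar> * \<bar>u' s\<bar> + 2 * \<bar>u' s\<bar> * (K * \<bar>u s\<bar>)"
      using K(2)[of s] by (intro add_left_mono mult_left_mono) auto
    also have "\<dots> = (1 + K) * (2 * \<bar>u s\<bar> * \<bar>u' s\<bar>)" by (simp add: algebra_simps)
    also have "\<dots> \<le> (1 + K) * ((u s)\<^sup>2 + (u' s)\<^sup>2)"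
      using sum_squares_bound[of "\<bar>u s\<bar>" "\<bar>u' s\<bar>"] K(1) by (intro mult_left_mono) auto
    finally have "(2 * u s * u' s + 2 * u' s * u'' s - (1 + K) * ((u s)\<^sup>2 + (u' s)\<^sup>2))
        * exp (- (1 + K) * s) \<le> 0"
      by (intro mult_nonpos_nonneg) auto
    with dy show "\<exists>d. (y has_real_derivative d) (at s) \<and> d \<le> 0" by blast
  qed
  also have "y r = 0" using zero by (simp add: y_def)
  finally have "((u t)\<^sup>2 + (u' t)\<^sup>2) \<le> 0"
    by (simp add: y_def mult_le_0_iff)
  then show ?thesis by (simp add: sum_power2_le_zero_iff)
qed

section \<open>Ground states\<close>

text \<open>
  Up to a factor, the Green function of \<open>- v''\<close> on \<open>{0..L}\<close> with zero boundary values and pole \<open>r\<close>.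
  Testing with it recovers the value at \<open>r\<close> at once, so the weak equation yields an explicit formula
  for \<open>u r\<close>, from which the smoothness of \<open>u\<close> can be read off.
\<close>

definition tent :: "real \<Rightarrow> real \<Rightarrow> real \<Rightarrow> real" where
  "tent L r t = (if t \<le> r then t / r else (L - t) / (L - r))"

lemma continuous_on_tent:
  assumes "0 < r" "r < L"
  shows "continuous_on {0..L} (tent L r)"
proof -
  have "continuous_on ({0..r} \<union> {r..L}) (\<lambda>t. if t \<le> r then t / r else (L - t) / (L - r))"
    by (rule continuous_on_cases) (use assms in \<open>auto intro!: continuous_intros\<close>)
  moreover have "{0..r} \<union> {r..L} = {0..L}" using assms by auto
  ultimately show ?thesis unfolding tent_def[abs_def] by simp
qed

lemma energy_le_add_tent:
  assumes u: "energy_le u 0 L 1" and r: "0 < r" "r < L"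
  shows "energy_le (\<lambda>t. u t + s * tent L r t) 0 L
    (1 + 2 * s * ((u r - u 0) / r + (u r - u L) / (L - r)) + s\<^sup>2 * (1 / r + 1 / (L - r)))"
proof -
  obtain e e' where e: "energy_le u 0 r e" "energy_le u r L e'" "e + e' \<le> 1"
    using energy_le_split[OF u less_imp_le[OF r(1)] less_imp_le[OF r(2)]] by blast
  have 1: "energy_le (\<lambda>t. u t + s * tent L r t) 0 r (e + 2 * (s / r) * (u r - u 0) + (s / r)\<^sup>2 * (r - 0))"
    by (rule energy_le_cong[OF energy_le_add_affine[OF e(1), of "s / r" 0]]) (auto simp: tent_def)
  have s: "s + r * s / (L - r) = L * s / (L - r)" using r by (simp add: field_simps)
  have 2: "energy_le (\<lambda>t. u t + s * tent L r t) r L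
      (e' + 2 * (- s / (L - r)) * (u L - u r) + (- s / (L - r))\<^sup>2 * (L - r))"
    by (rule energy_le_cong[OF energy_le_add_affine[OF e(2), of "- s / (L - r)" "s * L / (L - r)"]])
      (use r s in \<open>auto simp: tent_def diff_divide_distrib algebra_simps\<close>)
  have "(s / r)\<^sup>2 * (r - 0) = s\<^sup>2 * (1 / r)" "(- s / (L - r))\<^sup>2 * (L - r) = s\<^sup>2 * (1 / (L - r))"
    using r by (simp_all add: power2_eq_square)
  moreover have "2 * (- s / (L - r)) * (u L - u r) = 2 * s * ((u r - u L) / (L - r))"
    using r by (simp add: field_simps)
  ultimately show ?thesis
    using e(3) by (intro energy_le_mono[OF energy_le_glue[OF 1 2 less_imp_le[OF r(1)] less_imp_le[OF r(2)]]]) (simp add: algebra_simps)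
qed

text \<open>
  Green's identity: \<open>- ((L - t) W' t + W t)\<close> and \<open>W t - t W' t\<close> are antiderivatives of
  \<open>(L - t) g\<close> and \<open>t g\<close>, and the values of \<open>W'\<close> at \<open>r\<close> cancel.
\<close>

lemma integral_mult_tent:
  fixes W W' g :: "real \<Rightarrow> real"
  assumes W: "\<And>t. (W has_real_derivative W' t) (at t)"
    and W': "\<And>t. (W' has_real_derivative - g t) (at t)" and r: "0 < r" "r < L"
  shows "integral {0..L} (\<lambda>t. g t * tent L r t) = (W r - W 0) / r + (W r - W L) / (L - r)"
proof -
  have "((\<lambda>t. g t * tent L r t) has_integral
      (W r - r * W' r) / r - (W 0 - 0 * W' 0) / r) {0..r}"
  proof (rule fundamental_theorem_of_calculus)
    fix t assume "t \<in> {0..r}"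
    then show "((\<lambda>t. (W t - t * W' t) / r) has_vector_derivative g t * tent L r t) (at t within {0..r})"
      unfolding has_real_derivative_iff_has_vector_derivative[symmetric]
      using r by (auto intro!: derivative_eq_intros has_field_derivative_at_within[OF W]
          has_field_derivative_at_within[OF W'] simp: tent_def)
  qed (use r in auto)
  moreover have "((\<lambda>t. g t * tent L r t) has_integral
      (- (L - L) * W' L - W L) / (L - r) - (- (L - r) * W' r - W r) / (L - r)) {r..L}"
  proof (rule fundamental_theorem_of_calculus)
    fix t assume t: "t \<in> {r..L}"
    then have *: "tent L r t = (L - t) / (L - r)" using r by (auto simp: tent_def)
    have "g t * (L - t) = - (g t * (t - L))" by (simp add: algebra_simps)
    then have **: "- (g t * (t - L) / (L - r)) = g t * (L - t) / (L - r)" by simp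
    show "((\<lambda>t. (- (L - t) * W' t - W t) / (L - r)) has_vector_derivative g t * tent L r t)
        (at t within {r..L})"
      unfolding has_real_derivative_iff_has_vector_derivative[symmetric] *
      using r by (auto intro!: derivative_eq_intros has_field_derivative_at_within[OF W]
          has_field_derivative_at_within[OF W'] simp: **)
  qed (use r in auto)
  ultimately have "((\<lambda>t. g t * tent L r t) has_integral
      ((W r - r * W' r) / r - (W 0 - 0 * W' 0) / r +
       ((- (L - L) * W' L - W L) / (L - r) - (- (L - r) * W' r - W r) / (L - r)))) {0..L}"
    by (intro has_integral_combine[of 0 r L]) (use r in auto)
  moreover have "(r - L) * W' r = - ((L - r) * W' r)" by (simp add: algebra_simps)
  then have "(W r - r * W' r) / r - (W 0 - 0 * W' 0) / r +
       ((- (L - L) * W' L - W L) / (L - r) - (- (L - r) * W' r - W r) / (L - r))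
      = (W r - W 0) / r + (W r - W L) / (L - r)"
    using r by (simp add: diff_divide_distrib add_divide_distrib)
  ultimately show ?thesis by (metis integral_unique)
qed

text \<open>
  The last clause is maximality of \<open>M\<close> in scale-invariant form; \<open>u\<close> attains it with energy \<open>1\<close>.
\<close>

definition ground_state ::
    "(real \<Rightarrow> real) \<Rightarrow> real \<Rightarrow> real \<Rightarrow> (real \<Rightarrow> real) \<Rightarrow> (real \<Rightarrow> real) \<Rightarrow> real \<Rightarrow> bool" where
  "ground_state a p L u u' M \<longleftrightarrow>
     0 < M \<and> (\<forall>t. 0 < u t) \<and> (\<forall>t. u (t + L) = u t) \<and>
     (\<forall>t. (u has_real_derivative u' t) (at t)) \<and>
     (\<forall>t. (u' has_real_derivative - (a t * u t powr p / M)) (at t)) \<and>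
     integral {0..L} (\<lambda>t. (u' t)\<^sup>2) = 1 \<and>
     integral {0..L} (\<lambda>t. a t * ppow (p + 1) (u t)) = M \<and>
     (\<forall>v e. v 0 = v L \<longrightarrow> energy_le v 0 L e \<longrightarrow> 0 < e
       \<longrightarrow> integral {0..L} (\<lambda>t. a t * ppow (p + 1) (v t)) \<le> M * e powr ((p + 1) / 2))"

text \<open>
  Let \<open>g = a u\<^sup>p / M\<close> for the periodic extension \<open>u\<close> of a maximiser, and let \<open>W\<close> be the solution of
  \<open>W'' = - g\<close> with the boundary values of \<open>u\<close>.  The tents show that \<open>u = W\<close> inside a period.  The
  constant test function shows that \<open>g\<close> has mean zero, so that \<open>W'\<close> and then \<open>W\<close> are periodic: the
  derivatives match across the ends of the period.
\<close>

lemma ground_state_exists: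
  fixes a :: "real \<Rightarrow> real" and L p :: real
  assumes L: "0 < L" and p: "1 < p" and a: "continuous_on UNIV a" "\<And>t. a (t + L) = a t"
    and neg: "integral {0..L} a < 0"
    and v0: "v0 0 = v0 L" "energy_le v0 0 L e0"
      "0 < integral {0..L} (\<lambda>t. a t * ppow (p + 1) (v0 t))"
  obtains u u' M where "ground_state a p L u u' M"
proof -
  have ac: "continuous_on S a" for S using a(1) continuous_on_subset by blast
  have q: "0 < p + 1" using p by simp
  obtain w M where M: "0 < M" and w: "w 0 = w L" "\<And>t. t \<in> {0..L} \<Longrightarrow> 0 \<le> w t" "energy_le w 0 L 1"
    and Jw: "integral {0..L} (\<lambda>t. a t * ppow (p + 1) (w t)) = M"
    and max: "\<And>v e. v 0 = v L \<Longrightarrow> energy_le v 0 L e \<Longrightarrow> 0 < e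
      \<Longrightarrow> integral {0..L} (\<lambda>t. a t * ppow (p + 1) (v t)) \<le> M * e powr ((p + 1) / 2)"
    by (rule constrained_maximiser_exists[OF L q ac neg v0]) (rule that; assumption)
  have wc: "continuous_on {0..L} w" by (rule energy_le_continuous_on[OF w(3)])
  obtain u where uc: "continuous_on UNIV u" and uper: "\<And>t. u (t + L) = u t"
    and uw: "\<And>t. t \<in> {0..L} \<Longrightarrow> u t = w t"
    using periodic_extension[OF L wc w(1)] by blast
  have u_nonneg: "0 \<le> u t" for t
  proof -
    obtain s n where s: "s \<in> {0..<L}" "t = s + of_int n * L" by (rule periodic_reduce[OF L])
    then have "u t = w s" using periodic_add_of_int[of u L s n, OF uper] uw[of s] by simp
    then show ?thesis using w(2)[of s] s by simp
  qed
  define g where "g = (\<lambda>t. a t * ppow p (u t) / M)"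
  have gc: "continuous_on UNIV g"
    unfolding g_def by (intro continuous_intros ac uc) (use p M in auto)
  have gper: "g (t + L) = g t" for t by (simp add: g_def a(2) uper)
  have test: "integral {0..L} (\<lambda>t. g t * \<phi> t) = b"
    if "\<phi> 0 = \<phi> L" "continuous_on {0..L} \<phi>" "0 \<le> c"
      "\<And>s. energy_le (\<lambda>t. w t + s * \<phi> t) 0 L (1 + 2 * s * b + s\<^sup>2 * c)" for \<phi> b c
  proof -
    have "integral {0..L} (\<lambda>t. a t * ppow (p + 1 - 1) (w t) * \<phi> t) = M * b"
      by (rule critical_point_identity[OF _ ac w(1) wc Jw max that]) (use p in auto)
    moreover have "integral {0..L} (\<lambda>t. a t * ppow (p + 1 - 1) (w t) * \<phi> t)
        = integral {0..L} (\<lambda>t. M * (g t * \<phi> t))"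
      using M by (intro integral_cong) (simp add: g_def uw)
    ultimately show ?thesis using M by simp
  qed
  have g0: "integral {0..L} g = 0"
  proof -
    have "integral {0..L} (\<lambda>t. g t * 1) = 0"
    proof (rule test[where c = 0])
      show "energy_le (\<lambda>t. w t + s * 1) 0 L (1 + 2 * s * 0 + s\<^sup>2 * 0)" for s
        using energy_le_add_affine[OF w(3), of 0 s] by simp
    qed auto
    then show ?thesis by simp
  qed
  obtain P where P: "\<And>t. (P has_real_derivative g t) (at t)"
    using continuous_antiderivative[OF gc] by blast
  have "continuous_on UNIV P"
    using P by (meson DERIV_continuous continuous_at_imp_continuous_on)
  then obtain Q where Q: "\<And>t. (Q has_real_derivative P t) (at t)"
    using continuous_antiderivative by blast
  define \<kappa> where "\<kappa> = (Q L - Q 0) / L"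
  define W where "W = (\<lambda>t. u 0 + \<kappa> * t - (Q t - Q 0))"
  define W' where "W' = (\<lambda>t. \<kappa> - P t)"
  have W: "(W has_real_derivative W' t) (at t)" for t
    unfolding W_def W'_def by (auto intro!: derivative_eq_intros Q)
  have W': "(W' has_real_derivative - g t) (at t)" for t
    unfolding W'_def by (auto intro!: derivative_eq_intros P)
  have W0: "W 0 = u 0" "W L = u 0" using L by (auto simp: W_def \<kappa>_def)
  have "(g has_integral P L - P 0) {0..L}"
    by (rule fundamental_theorem_of_calculus)
      (use L P in \<open>auto simp: has_real_derivative_iff_has_vector_derivative[symmetric]
          intro: has_field_derivative_at_within\<close>)
  with g0 have PL: "P L = P 0" by (metis eq_iff_diff_eq_0 integral_unique)
  have Pper: "P (t + L) = P t" for t by (rule periodic_antiderivative[of P g L, OF P gper PL])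
  have W'per: "W' (t + L) = W' t" for t by (simp add: W'_def Pper)
  have Wper: "W (t + L) = W t" for t by (rule periodic_antiderivative[of W W' L, OF W W'per]) (simp add: W0)
  have "W t = u t" for t
  proof (rule periodic_eqI[of L W u, OF L Wper uper])
    fix r assume r: "r \<in> {0..<L}"
    show "W r = u r"
    proof (cases "r = 0")
      case False
      then have r: "0 < r" "r < L" using r by auto
      have "integral {0..L} (\<lambda>t. g t * tent L r t) = (w r - w 0) / r + (w r - w L) / (L - r)"
        by (rule test[OF _ continuous_on_tent[OF r] _ energy_le_add_tent[OF w(3) r]])
          (use r in \<open>auto simp: tent_def\<close>)
      then have "(u r - u 0) / r + (u r - u 0) / (L - r) = (W r - u 0) / r + (W r - u 0) / (L - r)"
        using integral_mult_tent[OF W W' r] uw[of r] uw[of 0] uw[of L] w(1) r L by (simp add: W0)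
      then have "(W r - u r) * (1 / r + 1 / (L - r)) = 0"
        by (simp add: algebra_simps diff_divide_distrib)
      moreover have "0 < 1 / r + 1 / (L - r)" using r by (intro add_pos_pos) auto
      ultimately show ?thesis by simp
    qed (simp add: W0)
  qed
  then have Wu: "W = u" by auto
  have du: "(u has_real_derivative W' t) (at t)" for t using W Wu by simp
  have ddu: "(W' has_real_derivative - (a t * u t powr p / M)) (at t)" for t
    using W'[of t] u_nonneg[of t] by (simp add: g_def ppow_of_nonneg)
  have Ju: "integral {0..L} (\<lambda>t. a t * ppow (p + 1) (u t)) = M"
    using Jw uw by (auto intro!: integral_cong simp flip: Jw)
  \<comment> \<open>at a zero, which is a minimum, \<open>u\<close> and \<open>u'\<close> vanish, and \<open>\<bar>u''\<bar> \<le> K u\<close> because \<open>p > 1\<close>\<close>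
  have pos: "0 < u t" for t
  proof (rule ccontr)
    assume "\<not> 0 < u t"
    then have ut: "u t = 0" using u_nonneg[of t] by simp
    then have u't: "W' t = 0"
      using DERIV_local_min[OF du, of 1 t] u_nonneg by auto
    obtain B where B: "0 < B" "\<And>t. \<bar>a t\<bar> \<le> B" using periodic_bounded[of L a, OF L a(2,1)] by blast
    obtain N where N: "0 < N" "\<And>t. \<bar>u t\<bar> \<le> N" using periodic_bounded[of L u, OF L uper uc] by blast
    have bound: "\<bar>- (a s * u s powr p / M)\<bar> \<le> B * N powr (p - 1) / M * \<bar>u s\<bar>" for s
    proof -
      have "u s powr p = u s powr (p - 1) * u s"
        using powr_mult_base[OF u_nonneg, of s "p - 1"] by (simp add: mult.commute)
      also have "\<dots> \<le> N powr (p - 1) * u s"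
        using N(2)[of s] u_nonneg[of s] p by (intro mult_right_mono powr_mono2) auto
      finally have "\<bar>a s\<bar> * u s powr p \<le> B * (N powr (p - 1) * u s)"
        using B u_nonneg[of s] by (intro mult_mono) auto
      then show ?thesis
        using M u_nonneg[of s] by (simp add: abs_mult divide_right_mono mult.assoc)
    qed
    have *: "u s = 0" if "t \<le> s" for s
      by (rule eq_zero_of_linear_differential_inequality[OF du ddu _ bound ut u't that])
        (use B(1) M in simp)
    have "u s = 0" for s
    proof -
      have "(t - s) / L \<le> of_int \<lceil>(t - s) / L\<rceil>" by simp
      then have "t - s \<le> of_int \<lceil>(t - s) / L\<rceil> * L" using L by (simp only: pos_divide_le_eq)
      then have "t \<le> s + of_int \<lceil>(t - s) / L\<rceil> * L" by simp
      from *[OF this] show ?thesis using periodic_add_of_int[of u L s, OF uper] by simp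
    qed
    then have "M = 0" using Ju by (simp add: ppow_def)
    then show False using M by simp
  qed
  have W'c: "continuous_on S W'" for S
    using W' by (meson DERIV_continuous continuous_at_imp_continuous_on)
  have uc': "continuous_on S u" for S using uc continuous_on_subset by blast
  \<comment> \<open>multiply the equation by \<open>u\<close> and integrate by parts over the period\<close>
  have "((\<lambda>t. (W' t)\<^sup>2 - u t * g t) has_integral (u L * W' L - u 0 * W' 0)) {0..L}"
  proof (rule fundamental_theorem_of_calculus)
    fix t assume "t \<in> {0..L}"
    show "((\<lambda>t. u t * W' t) has_vector_derivative (W' t)\<^sup>2 - u t * g t) (at t within {0..L})"
      unfolding has_real_derivative_iff_has_vector_derivative[symmetric]
      by (rule has_field_derivative_at_within)
        (auto intro!: derivative_eq_intros du W' simp: power2_eq_square algebra_simps)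
  qed (use L in auto)
  moreover have "u L * W' L - u 0 * W' 0 = 0" using uper[of 0] W'per[of 0] by simp
  ultimately have "integral {0..L} (\<lambda>t. (W' t)\<^sup>2 - u t * g t) = 0" by (metis integral_unique)
  moreover have "integral {0..L} (\<lambda>t. (W' t)\<^sup>2 - u t * g t)
      = integral {0..L} (\<lambda>t. (W' t)\<^sup>2) - integral {0..L} (\<lambda>t. u t * g t)"
    by (intro Henstock_Kurzweil_Integration.integral_diff integrable_continuous_real
        continuous_intros W'c uc' continuous_on_subset[OF gc]) auto
  moreover have "integral {0..L} (\<lambda>t. u t * g t) = integral {0..L} (\<lambda>t. (1 / M) * (a t * ppow (p + 1) (u t)))"
  proof (rule integral_cong)
    fix t
    have "u t * u t powr p = u t powr (p + 1)"
      using powr_mult_base[OF u_nonneg, of t p] by (simp add: add.commute)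
    then have "u t * ppow p (u t) = ppow (p + 1) (u t)" using u_nonneg by (simp add: ppow_of_nonneg)
    then show "u t * g t = (1 / M) * (a t * ppow (p + 1) (u t))"
      unfolding g_def by (simp add: mult.left_commute)
  qed
  ultimately have "integral {0..L} (\<lambda>t. (W' t)\<^sup>2) = 1"
    using Ju M by (simp only: integral_mult_right) simp
  then have "ground_state a p L u W' M"
    unfolding ground_state_def using M pos uper du ddu Ju max by blast
  then show thesis by (rule that)
qed

section \<open>Cells and cutting off\<close>

lemma integral_over_period:
  fixes f :: "real \<Rightarrow> real"
  assumes "0 \<le> L" "continuous_on UNIV f" "\<And>t. f (t + L) = f t"
  shows "integral {x..x + L} f = integral {0..L} f"
proof -
  obtain F where F: "\<And>t. (F has_real_derivative f t) (at t)"
    using continuous_antiderivative[OF assms(2)] by blast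
  have I: "integral {y..y + L} f = F (y + L) - F y" for y
    by (rule integral_unique, rule fundamental_theorem_of_calculus)
      (use assms(1) F in \<open>auto simp: has_real_derivative_iff_has_vector_derivative[symmetric]
          intro: has_field_derivative_at_within\<close>)
  have "((\<lambda>t. F (t + L) - F t) has_real_derivative 0) (at t)" for t
    using DERIV_diff[OF DERIV_shift[THEN iffD1, OF F[of "t + L"]] F[of t]] assms(3)
    by simp
  then have "F (x + L) - F x = F (0 + L) - F 0"
    by (intro DERIV_const_ratio_const DERIV_isconst_all) auto
  then show ?thesis using I[of x] I[of 0] by simp
qed

lemma integral_eq_sum_cells:
  fixes f :: "real \<Rightarrow> real"
  assumes "0 \<le> h" "continuous_on UNIV f"
  shows "integral {0..real n * h} f = (\<Sum>j<n. integral {real j * h..real j * h + h} f)"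
proof (induction n)
  case (Suc n)
  have "integral {0..real n * h} f + integral {real n * h..real (Suc n) * h} f
      = integral {0..real (Suc n) * h} f"
    by (rule Henstock_Kurzweil_Integration.integral_combine)
      (use assms in \<open>auto simp: algebra_simps intro!: integrable_continuous_real
        intro: continuous_on_subset\<close>)
  then show ?case using Suc by (simp add: algebra_simps)
qed simp

lemma integral_over_periods:
  fixes f :: "real \<Rightarrow> real"
  assumes "0 \<le> L" "continuous_on UNIV f" "\<And>t. f (t + L) = f t"
  shows "integral {0..real n * L} f = real n * integral {0..L} f"
  using integral_over_period[OF assms]
  by (simp add: integral_eq_sum_cells[OF assms(1,2)])

lemma sum_powr_le_powr_sum:
  fixes x :: "nat \<Rightarrow> real"
  assumes "1 \<le> r" "\<And>j. j \<in> S \<Longrightarrow> 0 \<le> x j" "finite S"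
  shows "(\<Sum>j\<in>S. x j powr r) \<le> (\<Sum>j\<in>S. x j) powr r"
proof -
  have s: "0 \<le> (\<Sum>j\<in>S. x j)" by (intro sum_nonneg assms)
  have "(\<Sum>j\<in>S. x j powr r) \<le> (\<Sum>j\<in>S. x j * (\<Sum>j\<in>S. x j) powr (r - 1))"
  proof (rule sum_mono)
    fix i assume i: "i \<in> S"
    have "x i powr r = x i * x i powr (r - 1)"
      using powr_mult_base[OF assms(2)[OF i], of "r - 1"] by simp
    also have "\<dots> \<le> x i * (\<Sum>j\<in>S. x j) powr (r - 1)"
      using assms i by (intro mult_left_mono powr_mono2 member_le_sum) auto
    finally show "x i powr r \<le> x i * (\<Sum>j\<in>S. x j) powr (r - 1)" .
  qed
  also have "\<dots> = (\<Sum>j\<in>S. x j) * (\<Sum>j\<in>S. x j) powr (r - 1)" by (simp add: sum_distrib_right)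
  also have "\<dots> = (\<Sum>j\<in>S. x j) powr r" using powr_mult_base[OF s, of "r - 1"] by simp
  finally show ?thesis .
qed

text \<open>
  The function \<open>u\<close> on \<open>{x..y}\<close>, joined linearly to zero over a length \<open>T\<close> on each side.
\<close>

definition truncation :: "(real \<Rightarrow> real) \<Rightarrow> real \<Rightarrow> real \<Rightarrow> real \<Rightarrow> real \<Rightarrow> real" where
  "truncation u T x y t =
     (if t \<le> x - T then 0 else if t \<le> x then u x * (t - (x - T)) / T
      else if t \<le> y then u t else if t \<le> y + T then u y * (y + T - t) / T else 0)"

lemma energy_le_truncation:
  assumes T: "0 < T" and x: "T \<le> x" "x \<le> y" "y + T \<le> L"
    and u: "energy_le u x y e" and \<delta>: "\<bar>u x\<bar> \<le> \<delta>" "\<bar>u y\<bar> \<le> \<delta>"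
  shows "energy_le (truncation u T x y) 0 L (e + 2 * \<delta>\<^sup>2 / T)"
proof -
  let ?v = "truncation u T x y"
  have 1: "energy_le ?v 0 (x - T) 0"
    by (rule energy_le_cong[OF energy_le_affine[of 0 0 0 "x - T", simplified]])
      (simp add: truncation_def)
  have 2: "energy_le ?v (x - T) x ((u x / T)\<^sup>2 * (x - (x - T)))"
    by (rule energy_le_cong[OF energy_le_affine[of "u x / T" "- (u x / T) * (x - T)"]])
      (use T in \<open>auto simp: truncation_def right_diff_distrib diff_divide_distrib\<close>)
  have 3: "energy_le ?v x y e"
    by (rule energy_le_cong[OF u]) (use T in \<open>auto simp: truncation_def\<close>)
  have 4: "energy_le ?v y (y + T) ((- u y / T)\<^sup>2 * (y + T - y))"
    by (rule energy_le_cong[OF energy_le_affine[of "- u y / T" "(u y / T) * (y + T)"]])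
      (use T x in \<open>auto simp: truncation_def field_simps\<close>)
  have 5: "energy_le ?v (y + T) L 0"
    by (rule energy_le_cong[OF energy_le_affine[of 0 0 "y + T" L, simplified]])
      (use T x in \<open>auto simp: truncation_def\<close>)
  have "(u x)\<^sup>2 \<le> \<delta>\<^sup>2" "(u y)\<^sup>2 \<le> \<delta>\<^sup>2"
    using \<delta> power_mono[of "\<bar>u x\<bar>" \<delta> 2] power_mono[of "\<bar>u y\<bar>" \<delta> 2] by simp_all
  then have "(u x)\<^sup>2 / T + (u y)\<^sup>2 / T \<le> 2 * \<delta>\<^sup>2 / T"
    using T divide_right_mono[of "(u x)\<^sup>2 + (u y)\<^sup>2" "2 * \<delta>\<^sup>2" T]
    by (simp add: add_divide_distrib)
  moreover have "(u x / T)\<^sup>2 * (x - (x - T)) = (u x)\<^sup>2 / T"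
    "(- u y / T)\<^sup>2 * (y + T - y) = (u y)\<^sup>2 / T"
    using T by (simp_all add: power2_eq_square)
  moreover have "energy_le ?v 0 L
      (0 + (u x / T)\<^sup>2 * (x - (x - T)) + e + (- u y / T)\<^sup>2 * (y + T - y) + 0)"
    by (intro energy_le_glue[OF energy_le_glue[OF energy_le_glue[OF energy_le_glue[OF 1 2] 3] 4] 5])
      (use T x in auto)
  ultimately show ?thesis by (elim energy_le_mono) simp
qed

lemma integral_truncation_ge:
  fixes a u :: "real \<Rightarrow> real"
  assumes T: "0 < T" and q: "0 < q" and x: "T \<le> x" "x \<le> y" "y + T \<le> L"
    and a: "continuous_on {0..L} a" "\<And>t. \<bar>a t\<bar> \<le> B"
    and v: "continuous_on {0..L} (truncation u T x y)" and \<delta>: "0 \<le> u x" "u x \<le> \<delta>" "0 \<le> u y" "u y \<le> \<delta>"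
  shows "integral {x..y} (\<lambda>t. a t * ppow q (u t)) - 2 * B * T * \<delta> powr q
    \<le> integral {0..L} (\<lambda>t. a t * ppow q (truncation u T x y t))"
proof -
  let ?f = "\<lambda>t. a t * ppow q (truncation u T x y t)"
  have B: "0 \<le> B" using a(2)[of 0] by simp
  have fc: "continuous_on {0..L} ?f" by (intro continuous_intros a v q)
  have fi: "?f integrable_on {0..L}" by (rule integrable_continuous_real[OF fc])
  have comb: "integral {r..s} ?f + integral {s..t} ?f = integral {r..t} ?f"
    if "0 \<le> r" "r \<le> s" "s \<le> t" "t \<le> L" for r s t
    by (rule Henstock_Kurzweil_Integration.integral_combine)
      (use that in \<open>auto intro!: integrable_subinterval_real[OF fi]\<close>)
  have ramp: "- (B * T * \<delta> powr q) \<le> integral {r..r + T} ?f"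
    if r: "0 \<le> r" "r + T \<le> L" and "\<And>t. t \<in> {r..r + T} \<Longrightarrow> truncation u T x y t \<le> \<delta>" for r
  proof -
    have "norm (integral {r..r + T} ?f) \<le> B * \<delta> powr q * (r + T - r)"
    proof (rule integral_bound)
      show "continuous_on {r..r + T} ?f" by (rule continuous_on_subset[OF fc]) (use r in auto)
      fix t assume t: "t \<in> {r..r + T}"
      have "ppow q (truncation u T x y t) \<le> ppow q \<delta>" using q that(3)[OF t] by (intro ppow_mono) auto
      also have "\<dots> = \<delta> powr q" using \<delta> by (intro ppow_of_nonneg) simp
      finally show "norm (?f t) \<le> B * \<delta> powr q"
        using a(2)[of t] B by (auto simp: abs_mult intro!: mult_mono)
    qed (use T in simp)
    then show ?thesis by (simp add: abs_le_iff mult_ac)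
  qed
  have frac: "c * s / T \<le> \<delta>" if "0 \<le> c" "c \<le> \<delta>" "0 \<le> s" "s \<le> T" for c s
  proof -
    have "c * s \<le> \<delta> * T" using that by (intro mult_mono) auto
    then show ?thesis using T by (simp add: pos_divide_le_eq)
  qed
  have "truncation u T x y t \<le> \<delta>" if "t \<in> {x - T..x - T + T}" for t
    using that \<delta> frac[of "u x" "t - (x - T)"] by (auto simp: truncation_def)
  then have 2: "- (B * T * \<delta> powr q) \<le> integral {x - T..x} ?f"
    using ramp[of "x - T"] x T by simp
  have "truncation u T x y t \<le> \<delta>" if "t \<in> {y..y + T}" for t
    using that \<delta> x T frac[of "u y" "y + T - t"] by (auto simp: truncation_def)
  then have 4: "- (B * T * \<delta> powr q) \<le> integral {y..y + T} ?f"
    using ramp[of y] x T by simp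
  have 1: "integral {0..x - T} ?f = 0"
    by (rule integral_unique[OF has_integral_is_0]) (simp add: truncation_def ppow_def)
  have "?f t = 0" if "t \<in> {y + T..L}" for t
    using that x T by (auto simp: truncation_def ppow_def)
  then have 5: "integral {y + T..L} ?f = 0" by (rule integral_unique[OF has_integral_is_0])
  have 3: "integral {x..y} ?f = integral {x..y} (\<lambda>t. a t * ppow q (u t))"
    by (rule integral_cong) (use T in \<open>auto simp: truncation_def\<close>)
  show ?thesis
    using comb[of 0 "x - T" L] comb[of "x - T" x L] comb[of x y L] comb[of y "y + T" L] 1 2 3 4 5 x T
    by simp
qed

text \<open>
  Summing the oscillation estimate over the cells, where the oscillation on the \<open>i\<close>-th cell is at most
  \<open>sqrt (T e\<^sub>i)\<close> for its energy \<open>e\<^sub>i\<close>, gives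
  \<open>J + A / 2 \<Sum> max\<^sub>i\<^sup>q \<le> C \<Sum> e\<^sub>i\<^bsup>q/2\<^esup> \<le> C E\<^bsup>q/2\<^esup>\<close>, the last step because \<open>q / 2 \<ge> 1\<close>.  The cell with the
  smallest maximum is the one to choose.
\<close>

lemma exists_small_cell:
  fixes a u u' :: "real \<Rightarrow> real" and T p A B E J :: real and d :: nat
  defines "C \<equiv> oscillation_const (B * T) A (p + 1) * T powr ((p + 1) / 2)"
  assumes T: "0 < T" and p: "1 < p" and d: "0 < d"
    and a: "continuous_on UNIV a" "\<And>t. a (t + T) = a t" "integral {0..T} a = - A" "0 < A"
      "\<And>t. \<bar>a t\<bar> \<le> B"
    and u: "\<And>t. 0 < u t" "\<And>t. (u has_real_derivative u' t) (at t)" "continuous_on UNIV u'"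
    and E: "integral {0..real d * T} (\<lambda>t. (u' t)\<^sup>2) = E"
    and J: "integral {0..real d * T} (\<lambda>t. a t * ppow (p + 1) (u t)) = J"
  shows "\<exists>j<d. \<exists>\<delta>>0. (\<forall>t\<in>{real j * T..real j * T + T}. u t \<le> \<delta>) \<and>
    J + real d * (A / 2 * \<delta> powr (p + 1)) \<le> C * E powr ((p + 1) / 2)"
proof -
  let ?cell = "\<lambda>j::nat. {real j * T..real j * T + T}"
  define e where "e = (\<lambda>j. integral (?cell j) (\<lambda>t. (u' t)\<^sup>2))"
  have B: "0 \<le> B" using a(5)[of 0] by simp
  have uc: "continuous_on UNIV u"
    using u(2) by (meson DERIV_continuous continuous_at_imp_continuous_on)
  have e0: "0 \<le> e j" for j
    unfolding e_def by (intro integral_nonneg integrable_continuous_real continuous_intros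
        continuous_on_subset[OF u(3)]) auto
  have "\<forall>j. \<exists>r\<in>?cell j. \<forall>t\<in>?cell j. u t \<le> u r"
    using T by (intro allI continuous_attains_sup continuous_on_subset[OF uc]) auto
  then have "\<exists>r. \<forall>j. r j \<in> ?cell j \<and> (\<forall>t\<in>?cell j. u t \<le> u (r j))"
    by (intro choice allI) blast
  then obtain r where r: "\<And>j. r j \<in> ?cell j" "\<And>j t. t \<in> ?cell j \<Longrightarrow> u t \<le> u (r j)"
    by blast
  have cell: "integral (?cell j) (\<lambda>t. a t * ppow (p + 1) (u t))
      \<le> C * e j powr ((p + 1) / 2) - A / 2 * u (r j) powr (p + 1)" for j
  proof -
    have en: "energy_le u (real j * T) (real j * T + T) (e j)"
      unfolding e_def by (rule energy_le_integral_square[OF _ u(3,2)]) (use T in simp)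
    have "integral (?cell j) (\<lambda>t. a t * ppow (p + 1) (u t))
        \<le> oscillation_const (B * T) A (p + 1) * sqrt (T * e j) powr (p + 1)
          - A / 2 * u (r j) powr (p + 1)"
    proof (rule weighted_power_integral_le[where B = B])
      fix s t assume "s \<in> ?cell j" "t \<in> ?cell j"
      then show "u t - u s \<le> sqrt (T * e j)"
        using energy_le_oscillation[OF en, of s t] by simp
    next
      show "integral (?cell j) a = - A"
        using integral_over_period[of T a "real j * T"] T a by simp
      show "continuous_on (?cell j) a" "continuous_on (?cell j) u"
        by (auto intro: continuous_on_subset a uc)
    qed (use T p a u(1) r(1)[of j] e0 in \<open>auto simp: less_imp_le\<close>)
    also have "sqrt (T * e j) powr (p + 1) = T powr ((p + 1) / 2) * e j powr ((p + 1) / 2)"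
      using T e0[of j] by (simp add: powr_half_sqrt[symmetric] powr_powr powr_mult)
    finally show ?thesis by (simp add: C_def mult.assoc)
  qed
  obtain j where j: "j < d" "\<And>i. i < d \<Longrightarrow> u (r j) \<le> u (r i)"
    using ex_is_arg_min_if_finite[of "{..<d}" "\<lambda>j. u (r j)"] d
    by (auto simp: is_arg_min_linorder)
  have C0: "0 \<le> C" using B T a(4) by (simp add: C_def oscillation_const_nonneg)
  have "J = (\<Sum>i<d. integral (?cell i) (\<lambda>t. a t * ppow (p + 1) (u t)))"
    unfolding J[symmetric] by (rule integral_eq_sum_cells)
      (use T p in \<open>auto intro!: continuous_intros a uc\<close>)
  also have "\<dots> \<le> (\<Sum>i<d. C * e i powr ((p + 1) / 2) - A / 2 * u (r i) powr (p + 1))"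
    by (intro sum_mono cell)
  also have "\<dots> \<le> (\<Sum>i<d. C * e i powr ((p + 1) / 2) - A / 2 * u (r j) powr (p + 1))"
    using j(2) a(4) p u(1) by (intro sum_mono diff_left_mono mult_left_mono powr_mono2)
      (auto simp: less_imp_le)
  also have "\<dots> = C * (\<Sum>i<d. e i powr ((p + 1) / 2)) - real d * (A / 2 * u (r j) powr (p + 1))"
    by (simp add: sum_subtractf sum_distrib_left)
  also have "\<dots> \<le> C * (\<Sum>i<d. e i) powr ((p + 1) / 2) - real d * (A / 2 * u (r j) powr (p + 1))"
    using C0 p e0 by (intro diff_right_mono mult_left_mono sum_powr_le_powr_sum) auto
  also have "(\<Sum>i<d. e i) = E"
    unfolding E[symmetric] e_def by (rule integral_eq_sum_cells[symmetric])
      (use T in \<open>auto intro!: continuous_intros u\<close>)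
  finally have "J + real d * (A / 2 * u (r j) powr (p + 1)) \<le> C * E powr ((p + 1) / 2)" by simp
  then show ?thesis using j(1) r(2) u(1) by blast
qed

section \<open>Minimal periods\<close>

lemma periodic_derivative:
  fixes u u' :: "real \<Rightarrow> real"
  assumes "\<And>t. u (t + L) = u t" "\<And>t. (u has_real_derivative u' t) (at t)"
  shows "u' (t + L) = u' t"
proof (rule DERIV_unique)
  show "(u has_real_derivative u' (t + L)) (at t)"
    using DERIV_shift[THEN iffD1, OF assms(2)[of "t + L"]] assms(1) by simp
qed (rule assms(2))

text \<open>
  The threshold depends on the ground states only through the lower bound \<open>c\<close> for \<open>M\<close>.  With \<open>N\<close>
  bounding the number \<open>m\<close> of repetitions, maximality applied to the cut-off copy gives \<open>1 \<le> f \<delta>\<close>,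
  where \<open>f \<delta>\<close> tends to \<open>2\<^bsup>- \<alpha>\<^esup> < 1\<close> as \<open>\<delta>\<close> tends to \<open>0\<close>.  Here \<open>\<alpha> = q / 2 - 1\<close> is the exponent
  in \<open>m m\<^bsup>- q/2\<^esup> = m\<^bsup>- \<alpha>\<^esup>\<close>.
\<close>

lemma minimal_period_threshold:
  fixes a :: "real \<Rightarrow> real" and T p A B c :: real
  assumes T: "0 < T" and p: "1 < p"
    and a: "continuous_on UNIV a" "\<And>t. a (t + T) = a t" "integral {0..T} a = - A" "0 < A"
      "\<And>t. \<bar>a t\<bar> \<le> B"
    and c: "0 < c"
  obtains K :: nat where "\<And>k d u u' M. K \<le> k \<Longrightarrow> d dvd k \<Longrightarrow> d < k \<Longrightarrow> c \<le> M
    \<Longrightarrow> ground_state a p (real k * T) u u' M \<Longrightarrow> \<not> (\<forall>t. u (t + real d * T) = u t)"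
proof -
  define q where "q = p + 1"
  define \<alpha> where "\<alpha> = (p - 1) / 2"
  have q: "0 < q" and q_half: "q / 2 = 1 + \<alpha>" and \<alpha>: "0 < \<alpha>"
    using p by (auto simp: q_def \<alpha>_def field_simps)
  have B: "0 \<le> B" using a(5)[of 0] by simp
  define C where "C = oscillation_const (B * T) A q * T powr (q / 2)"
  have C: "0 \<le> C" using B T a(4) by (simp add: C_def oscillation_const_nonneg)
  define N where "N = (C / c) powr (1 / \<alpha>)"
  define f where "f = (\<lambda>\<delta>. (1 / 2) powr \<alpha> * (1 + 2 * N * \<delta>\<^sup>2 / T) powr (q / 2) + 3 * B * T * N * \<delta> powr q / c)"
  have "((\<lambda>\<delta>. (1 / 2) powr \<alpha> * (1 + 2 * N * \<delta>\<^sup>2 / T) powr (q / 2) + 3 * B * T * N * \<delta> powr q / c)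
      \<longlongrightarrow> (1 / 2) powr \<alpha> * (1 + 2 * N * 0\<^sup>2 / T) powr (q / 2) + 3 * B * T * N * 0 powr q / c) (at_right 0)"
    by (intro tendsto_intros tendsto_powr') (use T c q in \<open>auto simp: eventually_at_right_less eventually_at_filter\<close>)
  then have "(f \<longlongrightarrow> (1 / 2) powr \<alpha>) (at_right 0)" using q by (simp add: f_def[abs_def])
  moreover have "(1 / 2) powr \<alpha> < 1" using powr_less_mono2[of \<alpha> "1 / 2" 1] \<alpha> by simp
  ultimately have "\<forall>\<^sub>F \<delta> in at_right 0. f \<delta> < 1" by (rule order_tendstoD(2))
  then obtain \<delta>0 where \<delta>0: "0 < \<delta>0" "\<And>\<delta>. 0 < \<delta> \<Longrightarrow> \<delta> < \<delta>0 \<Longrightarrow> f \<delta> < 1"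
    unfolding eventually_at_right_field by blast
  obtain K :: nat where K: "2 * C * N / (A * \<delta>0 powr q) < real K" using reals_Archimedean2 by blast
  show thesis
  proof (rule that, rule notI)
    fix k d u u' M
    assume k: "K \<le> k" and dk: "d dvd k" "d < k" and cM: "c \<le> M"
      and gs: "ground_state a p (real k * T) u u' M"
      and per: "\<forall>t. u (t + real d * T) = u t"
    from gs have M: "0 < M" and u0: "\<And>t. 0 < u t"
      and du: "\<And>t. (u has_real_derivative u' t) (at t)"
      and ddu: "\<And>t. (u' has_real_derivative - (a t * u t powr p / M)) (at t)"
      and E1: "integral {0..real k * T} (\<lambda>t. (u' t)\<^sup>2) = 1"
      and J1: "integral {0..real k * T} (\<lambda>t. a t * ppow q (u t)) = M"
      and max: "\<And>v e. v 0 = v (real k * T) \<Longrightarrow> energy_le v 0 (real k * T) e \<Longrightarrow> 0 < e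
        \<Longrightarrow> integral {0..real k * T} (\<lambda>t. a t * ppow q (v t)) \<le> M * e powr (q / 2)"
      unfolding ground_state_def q_def by blast+
    obtain m where m: "k = m * d" using dk(1) by (metis dvd_def mult.commute)
    have d0: "0 < d" using dk by (cases "d = 0") auto
    have m2: "2 \<le> m" using m dk(2) d0 by (cases m; cases "m - 1") auto
    have kT: "real k * T = real m * (real d * T)" by (simp add: m)
    have uc: "continuous_on UNIV u" and u'c: "continuous_on UNIV u'"
      using du ddu by (meson DERIV_continuous continuous_at_imp_continuous_on)+
    have perd: "u (t + real d * T) = u t" "u' (t + real d * T) = u' t"
      "a (t + real d * T) = a t" for t
      using per periodic_derivative[of u "real d * T" u', OF _ du]
        periodic_add_of_int[of a T t "int d", OF a(2)] by auto
    have "real m * integral {0..real d * T} (\<lambda>t. (u' t)\<^sup>2) = 1"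
      unfolding E1[symmetric] kT
      by (rule integral_over_periods[symmetric])
        (use T in \<open>auto intro!: continuous_intros u'c simp: perd\<close>)
    then have E: "integral {0..real d * T} (\<lambda>t. (u' t)\<^sup>2) = 1 / real m"
      using m2 by (simp add: field_simps)
    have "real m * integral {0..real d * T} (\<lambda>t. a t * ppow q (u t)) = M"
      unfolding J1[symmetric] kT
      by (rule integral_over_periods[symmetric])
        (use T q in \<open>auto intro!: continuous_intros uc a simp: perd\<close>)
    then have J: "integral {0..real d * T} (\<lambda>t. a t * ppow q (u t)) = M / real m"
      using m2 by (simp add: field_simps)
    obtain j \<delta> where j: "j < d" and \<delta>: "0 < \<delta>" "\<And>t. t \<in> {real j * T..real j * T + T} \<Longrightarrow> u t \<le> \<delta>"
      and small: "M / real m + real d * (A / 2 * \<delta> powr q) \<le> C * (1 / real m) powr (q / 2)"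
      using exists_small_cell[OF T p d0 a u0 du u'c E J[unfolded q_def]]
      unfolding C_def q_def by blast
    have m_powr: "real m * (1 / real m) powr (q / 2) = (1 / real m) powr \<alpha>"
      using m2 by (simp add: q_half powr_add)
    \<comment> \<open>the energy \<open>1 / m\<close> must produce \<open>M / m \<ge> c / m\<close>, which bounds the number of repetitions\<close>
    have "M / real m \<le> C * (1 / real m) powr (q / 2)"
      using small a(4) by (smt (verit) mult_nonneg_nonneg of_nat_0_le_iff powr_ge_zero divide_nonneg_nonneg)
    then have "M \<le> C * (real m * (1 / real m) powr (q / 2))"
      using m2 by (simp add: field_simps)
    then have "c \<le> C * (1 / real m) powr \<alpha>" using cM m_powr by simp
    then have "real m powr \<alpha> \<le> C / c" using c m2 by (simp add: powr_divide field_simps)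
    then have "(real m powr \<alpha>) powr (1 / \<alpha>) \<le> N"
      unfolding N_def using \<alpha> by (intro powr_mono2) auto
    then have mN: "real m \<le> N" using \<alpha> m2 by (simp add: powr_powr)
    \<comment> \<open>the number \<open>d = k / m\<close> of cells is large, which makes \<open>\<delta>\<close> small\<close>
    have "(1 / real m) powr (q / 2) \<le> 1" using m2 q by (intro powr_le1) auto
    then have "C * (1 / real m) powr (q / 2) \<le> C" using C by (simp add: mult_left_le)
    moreover have "0 \<le> M / real m" using M by simp
    ultimately have "real d * (A / 2 * \<delta> powr q) \<le> C" using small by linarith
    then have "real m * (real d * (A / 2 * \<delta> powr q)) \<le> N * C"
      using mN C M a(4) by (intro mult_mono) auto
    then have "real k * (A * \<delta> powr q) \<le> 2 * C * N" by (simp add: m algebra_simps)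
    also have "2 * C * N < real k * (A * \<delta>0 powr q)"
    proof -
      have "2 * C * N / (A * \<delta>0 powr q) < real k" using K k by linarith
      then show ?thesis using a(4) \<delta>0(1) by (simp add: pos_divide_less_eq)
    qed
    finally have "\<delta> powr q < \<delta>0 powr q" using a(4) d0 dk by simp
    then have "\<delta> < \<delta>0" using \<delta>(1) \<delta>0(1) q powr_mono2[of q \<delta>0 \<delta>] by (meson less_imp_le not_le)
    with \<delta>0(2) \<delta>(1) have f1: "f \<delta> < 1" by blast
    \<comment> \<open>cut off on the small cell and on its translate by \<open>d T\<close>; both lie in \<open>{0..k T}\<close> as \<open>m \<ge> 2\<close>\<close>
    define x where "x = real j * T + T"
    define y where "y = real j * T + real d * T"
    have xy: "T \<le> x" "x \<le> y" "y + T \<le> real k * T"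
    proof -
      show "T \<le> x" using T by (simp add: x_def)
      have "1 * T \<le> real d * T" using d0 T by (intro mult_right_mono) auto
      then show "x \<le> y" by (simp add: x_def y_def)
      have "j + d + 1 \<le> k" using j m2 m mult_le_mono1[of 2 m d] by linarith
      then have "real (j + d + 1) * T \<le> real k * T" using T by (intro mult_right_mono) auto
      then show "y + T \<le> real k * T" by (simp add: y_def algebra_simps)
    qed
    have ux: "u x \<le> \<delta>" and uy: "u y \<le> \<delta>"
      using \<delta>(2)[of x] \<delta>(2)[of "real j * T"] perd(1)[of "real j * T"] T by (auto simp: x_def y_def)
    have c2: "continuous_on S (\<lambda>t. (u' t)\<^sup>2)" "continuous_on S (\<lambda>t. a t * ppow q (u t))"
      "continuous_on S a" for S
      using q by (auto intro!: continuous_intros intro: continuous_on_subset uc u'c a)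
    have comb: "integral {real j * T..x} g + integral {x..y} g = integral {real j * T..y} g"
      if "continuous_on {real j * T..y} g" for g :: "real \<Rightarrow> real"
      by (rule Henstock_Kurzweil_Integration.integral_combine)
        (use T xy that in \<open>auto simp: x_def intro!: integrable_continuous_real\<close>)
    have "integral {real j * T..y} (\<lambda>t. (u' t)\<^sup>2) = 1 / real m"
      unfolding y_def E[symmetric] by (rule integral_over_period) (use T c2 perd in auto)
    moreover have "0 \<le> integral {real j * T..x} (\<lambda>t. (u' t)\<^sup>2)"
      by (intro integral_nonneg integrable_continuous_real c2) auto
    ultimately have "energy_le u x y (1 / real m)"
      using energy_le_mono[OF energy_le_integral_square[OF xy(2) u'c du], of "1 / real m"]
        comb[OF c2(1)] by simp
    then have en: "energy_le (truncation u T x y) 0 (real k * T) (1 / real m + 2 * \<delta>\<^sup>2 / T)"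
      using ux uy u0 by (intro energy_le_truncation[OF T xy]) (auto simp: abs_of_pos)
    have "norm (integral {real j * T..x} (\<lambda>t. a t * ppow q (u t))) \<le> B * \<delta> powr q * (x - real j * T)"
    proof (rule integral_bound)
      fix t assume "t \<in> {real j * T..x}"
      then have "ppow q (u t) \<le> ppow q \<delta>" using \<delta>(2)[of t] q by (intro ppow_mono) (auto simp: x_def)
      also have "\<dots> = \<delta> powr q" using \<delta>(1) by (simp add: ppow_of_nonneg)
      finally show "norm (a t * ppow q (u t)) \<le> B * \<delta> powr q"
        using a(5)[of t] B by (auto simp: abs_mult intro!: mult_mono)
    qed (use T c2 in \<open>auto simp: x_def\<close>)
    then have "integral {real j * T..x} (\<lambda>t. a t * ppow q (u t)) \<le> B * T * \<delta> powr q"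
      by (simp add: x_def mult_ac)
    moreover have "integral {real j * T..y} (\<lambda>t. a t * ppow q (u t)) = M / real m"
      unfolding y_def J[symmetric] by (rule integral_over_period) (use T c2 perd in auto)
    moreover have "integral {x..y} (\<lambda>t. a t * ppow q (u t)) - 2 * B * T * \<delta> powr q
        \<le> integral {0..real k * T} (\<lambda>t. a t * ppow q (truncation u T x y t))"
      by (rule integral_truncation_ge[OF T q xy c2(3) a(5) energy_le_continuous_on[OF en]])
        (use ux uy u0 in \<open>auto simp: less_imp_le\<close>)
    moreover have "integral {0..real k * T} (\<lambda>t. a t * ppow q (truncation u T x y t))
        \<le> M * (1 / real m + 2 * \<delta>\<^sup>2 / T) powr (q / 2)"
    proof (rule max[OF _ en])
      show "truncation u T x y 0 = truncation u T x y (real k * T)"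
        using T xy by (auto simp: truncation_def)
      show "0 < 1 / real m + 2 * \<delta>\<^sup>2 / T" using m2 T by (intro add_pos_nonneg) auto
    qed
    ultimately have "M / real m - 3 * B * T * \<delta> powr q \<le> M * (1 / real m + 2 * \<delta>\<^sup>2 / T) powr (q / 2)"
      using comb[OF c2(2)] by simp
    also have "1 / real m + 2 * \<delta>\<^sup>2 / T = (1 / real m) * (1 + 2 * real m * \<delta>\<^sup>2 / T)"
      using m2 by (simp add: field_simps)
    also have "\<dots> powr (q / 2) = (1 / real m) powr (q / 2) * (1 + 2 * real m * \<delta>\<^sup>2 / T) powr (q / 2)"
      by (rule powr_mult)
    finally have "real m * (M / real m - 3 * B * T * \<delta> powr q)
        \<le> real m * (M * ((1 / real m) powr (q / 2) * (1 + 2 * real m * \<delta>\<^sup>2 / T) powr (q / 2)))"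
      by (rule mult_left_mono) simp
    then have "M - 3 * B * T * real m * \<delta> powr q
        \<le> M * ((real m * (1 / real m) powr (q / 2)) * (1 + 2 * real m * \<delta>\<^sup>2 / T) powr (q / 2))"
      using m2 by (simp add: algebra_simps)
    also have "\<dots> \<le> M * ((1 / 2) powr \<alpha> * (1 + 2 * N * \<delta>\<^sup>2 / T) powr (q / 2))"
      unfolding m_powr using m2 mN M \<alpha> q T
      by (intro mult_left_mono mult_mono powr_mono2 add_left_mono divide_right_mono mult_right_mono)
        (auto simp: field_simps)
    also have "\<dots> = M * f \<delta> - M * (3 * B * T * N * \<delta> powr q / c)"
      by (simp add: f_def algebra_simps)
    finally have "M - M * f \<delta> \<le> 3 * B * T * real m * \<delta> powr q - M * (3 * B * T * N * \<delta> powr q / c)"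
      by simp
    moreover have "3 * B * T * real m * \<delta> powr q \<le> 3 * B * T * N * \<delta> powr q"
      using mN B T by (intro mult_right_mono mult_left_mono) auto
    moreover have "3 * B * T * N * \<delta> powr q \<le> M * (3 * B * T * N * \<delta> powr q / c)"
    proof -
      have "0 \<le> N" using mN by linarith
      then have "1 * (3 * B * T * N * \<delta> powr q) \<le> (M / c) * (3 * B * T * N * \<delta> powr q)"
        using cM c B T by (intro mult_right_mono) auto
      then show ?thesis by simp
    qed
    ultimately have "M - M * f \<delta> \<le> 0" by linarith
    then have "M * (1 - f \<delta>) \<le> 0" by (simp add: algebra_simps)
    then show False using M f1 by (simp add: mult_le_0_iff)
  qed
qed

text \<open>
  A bump inside one period, supported where \<open>a > 0\<close>, bounds \<open>M\<close> from below uniformly in the number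
  of periods.
\<close>

lemma localized_competitor:
  fixes a :: "real \<Rightarrow> real" and T q :: real
  assumes T: "0 < T" and q: "0 < q" and a: "continuous_on UNIV a" "\<And>t. a (t + T) = a t"
    and pos: "\<exists>t. 0 < a t"
  obtains v c where "0 < c" "\<And>L. T \<le> L \<Longrightarrow> v 0 = v L" "\<And>L. T \<le> L \<Longrightarrow> energy_le v 0 L T"
    "\<And>L. T \<le> L \<Longrightarrow> integral {0..L} (\<lambda>t. a t * ppow q (v t)) = c"
proof -
  obtain t where "0 < a t" using pos by blast
  obtain s n where s: "s \<in> {0..<T}" "t = s + of_int n * T" by (rule periodic_reduce[OF T])
  then have as: "0 < a s" using \<open>0 < a t\<close> periodic_add_of_int[of a T s n, OF a(2)] by simp
  have "open {x. 0 < a x}" using a(1) by (intro open_Collect_less continuous_intros)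
  then obtain \<epsilon> where \<epsilon>: "0 < \<epsilon>" "ball s \<epsilon> \<subseteq> {x. 0 < a x}"
    using as by (auto elim: openE)
  \<comment> \<open>centring at \<open>s + \<rho>\<close> keeps the support inside \<open>{0..T}\<close> even when \<open>s = 0\<close>\<close>
  define \<rho> where "\<rho> = min \<epsilon> (T - s) / 2"
  define r where "r = s + \<rho>"
  have \<rho>: "0 < \<rho>" "2 * \<rho> \<le> \<epsilon>" "2 * \<rho> \<le> T - s" using \<epsilon>(1) s by (auto simp: \<rho>_def)
  define v where "v = (\<lambda>t. max (\<rho> - \<bar>t - r\<bar>) 0)"
  have v_zero: "v t = 0" if "t \<le> 0 \<or> T \<le> t" for t
    using that \<rho> s by (auto simp: v_def r_def)
  have v_pos: "0 < a t" if "v t \<noteq> 0" for t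
  proof -
    have "\<bar>t - r\<bar> < \<rho>" using that by (auto simp: v_def max_def split: if_splits)
    then have "t \<in> ball s \<epsilon>" using \<rho> by (auto simp: r_def dist_real_def)
    then show ?thesis using \<epsilon>(2) by blast
  qed
  have vc: "continuous_on S v" for S unfolding v_def by (intro continuous_intros)
  have fc: "continuous_on S (\<lambda>t. a t * ppow q (v t))" for S
    by (intro continuous_intros vc q continuous_on_subset[OF a(1)]) auto
  have nonneg: "0 \<le> a t * ppow q (v t)" for t
    using v_pos[of t] by (cases "v t = 0") (auto simp: ppow_def)
  define c where "c = integral {0..T} (\<lambda>t. a t * ppow q (v t))"
  have "c \<noteq> 0"
  proof
    assume "c = 0"
    then have "\<forall>t\<in>{0..T}. a t * ppow q (v t) = 0"
      unfolding c_def using integral_eq_0_iff[OF fc T nonneg] by blast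
    moreover have "r \<in> {0..T}" using \<rho> s by (auto simp: r_def)
    ultimately have "a r * ppow q (v r) = 0" by blast
    moreover have "v r = \<rho>" using \<rho> by (simp add: v_def)
    ultimately show False using v_pos[of r] \<rho>(1) by (simp add: ppow_def)
  qed
  moreover have "0 \<le> c"
    unfolding c_def by (intro integral_nonneg integrable_continuous_real fc nonneg)
  ultimately have "0 < c" by simp
  moreover have "energy_le v 0 L T" if L: "T \<le> L" for L
  proof -
    have "energy_le v 0 T T"
    proof (rule energy_leI[of "\<lambda>t. t"])
      fix s t :: real assume "s \<le> t"
      then have "\<bar>v t - v s\<bar> \<le> \<bar>t - s\<bar>" by (auto simp: v_def max_def)
      then show "(v t - v s)\<^sup>2 \<le> (t - s) * (t - s)"
        by (simp add: abs_le_square_iff flip: power2_eq_square)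
    qed simp
    moreover have "energy_le v T L 0"
      by (rule energy_le_cong[OF energy_le_affine[of 0 0 T L, simplified]]) (simp add: v_zero)
    ultimately show ?thesis using energy_le_glue[of v 0 T T L 0] T L by simp
  qed
  moreover have "integral {0..L} (\<lambda>t. a t * ppow q (v t)) = c" if L: "T \<le> L" for L
  proof -
    have "integral {T..L} (\<lambda>t. a t * ppow q (v t)) = 0"
      by (rule integral_unique[OF has_integral_is_0]) (simp add: v_zero ppow_def)
    then show ?thesis
      unfolding c_def
      using Henstock_Kurzweil_Integration.integral_combine[of 0 T L "\<lambda>t. a t * ppow q (v t)"]
        integrable_continuous_real[OF fc] T L by simp
  qed
  ultimately show thesis using that[of c v] v_zero T by auto
qed

text \<open>
  The degrees of homogeneity \<open>1\<close> and \<open>p\<close> of the two terms differ, so a suitable multiple absorbs the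
  Lagrange multiplier \<open>1 / M\<close>.
\<close>

lemma solution_of_ground_state:
  assumes gs: "ground_state a p L u u' M" and p: "1 < p"
  shows "\<exists>c>0. solution a p (\<lambda>t. c * u t)"
proof -
  define c where "c = (1 / M) powr (1 / (p - 1))"
  have M: "0 < M" and u0: "\<And>t. 0 < u t" and du: "\<And>t. (u has_real_derivative u' t) (at t)"
    and ddu: "\<And>t. (u' has_real_derivative - (a t * u t powr p / M)) (at t)"
    using gs unfolding ground_state_def by blast+
  have c: "0 < c" using M by (simp add: c_def)
  have "c powr (p - 1) = 1 / M" using M p by (simp add: c_def powr_powr)
  then have cp: "c powr p = c / M" using powr_mult_base[of c "p - 1"] c by simp
  have "((\<lambda>t. c * u t) has_real_derivative c * u' t) (at t) \<and>
      ((\<lambda>t. c * u' t) has_real_derivative c * (- (a t * u t powr p / M))) (at t) \<and>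
      c * (- (a t * u t powr p / M)) + a t * (c * u t) powr p = 0" for t
    using DERIV_cmult[OF du] DERIV_cmult[OF ddu] cp by (simp add: powr_mult)
  then show ?thesis
    unfolding solution_def
    by (intro exI[of _ c] conjI c exI[of _ "\<lambda>t. c * u' t"]
        exI[of _ "\<lambda>t. c * (- (a t * u t powr p / M))"] allI) auto
qed

lemma periodic_gcd:
  fixes u :: "real \<Rightarrow> 'b"
  assumes "\<And>t. u (t + real k * T) = u t" "\<And>t. u (t + real l * T) = u t"
  shows "u (t + real (gcd k l) * T) = u t"
proof -
  obtain x y where xy: "x * int k + y * int l = gcd (int k) (int l)" using bezout_int by blast
  then have "real (gcd k l) = of_int (x * int k + y * int l)" by simp
  also have "\<dots> = of_int x * real k + of_int y * real l" by simp
  finally have "real (gcd k l) * T = of_int x * (real k * T) + of_int y * (real l * T)"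
    by (simp add: distrib_right mult.assoc)
  then have "u (t + real (gcd k l) * T) = u ((t + of_int x * (real k * T)) + of_int y * (real l * T))"
    by (simp add: add.assoc)
  also have "\<dots> = u t"
    using periodic_add_of_int[of u "real l * T", OF assms(2)]
      periodic_add_of_int[of u "real k * T", OF assms(1)] by simp
  finally show ?thesis .
qed

theorem theorem1p1:
  fixes T p :: real and a :: "real \<Rightarrow> real"
  assumes "T > 0" and "p > 1"
    and "continuous_on UNIV a"
    and "periodic_fun_simple a T"
    and "sign_changing a"
    and "finite {t \<in> {0..<T}. a t = 0}"
    and "integral {0..T} a < 0"
  shows "(\<exists>u. solution a p u \<and> everywhere_positive u \<and> periodic_fun_simple u T) \<and>
         (\<exists>k0\<ge>1. \<forall>k\<ge>k0. \<exists>u. subharmonic_solution a p T k u \<and> everywhere_positive u)"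
proof -
  have a: "continuous_on UNIV a" "\<And>t. a (t + T) = a t"
    using assms(3,4) by (auto simp: periodic_fun_simple_def)
  define A where "A = - integral {0..T} a"
  have A: "integral {0..T} a = - A" "0 < A" using assms(7) by (simp_all add: A_def)
  obtain B where B: "\<And>t. \<bar>a t\<bar> \<le> B" using periodic_bounded[of T a, OF assms(1) a(2,1)] by blast
  have q: "0 < p + 1" using assms(2) by simp
  have "\<exists>t. 0 < a t" using assms(5) by (auto simp: sign_changing_def)
  then obtain v c where c: "0 < c" and v: "\<And>L. T \<le> L \<Longrightarrow> v 0 = v L"
    "\<And>L. T \<le> L \<Longrightarrow> energy_le v 0 L T"
    "\<And>L. T \<le> L \<Longrightarrow> integral {0..L} (\<lambda>t. a t * ppow (p + 1) (v t)) = c"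
    by (rule localized_competitor[OF assms(1) q a]) (rule that; assumption)
  define c' where "c' = c / T powr ((p + 1) / 2)"
  have c': "0 < c'" using c assms(1) by (simp add: c'_def)
  have ground: "\<exists>u u' M. ground_state a p (real k * T) u u' M \<and> c' \<le> M" if k: "1 \<le> k" for k :: nat
  proof -
    have L: "0 < real k * T" "T \<le> real k * T" using k assms(1) by simp_all
    have ak: "a (t + real k * T) = a t" for t
      using periodic_add_of_int[of a T t "int k", OF a(2)] by simp
    have "integral {0..real k * T} a = real k * (- A)"
      using integral_over_periods[of T a k] assms(1) a A(1) by simp
    then have neg: "integral {0..real k * T} a < 0" using k A(2) by simp
    obtain u u' M where gs: "ground_state a p (real k * T) u u' M"
      using ground_state_exists[OF L(1) assms(2) a(1) ak neg v(1,2)[OF L(2)]] v(3)[OF L(2)] c by auto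
    then have "integral {0..real k * T} (\<lambda>t. a t * ppow (p + 1) (v t)) \<le> M * T powr ((p + 1) / 2)"
      using v(1,2)[OF L(2)] assms(1) unfolding ground_state_def by blast
    then have "c \<le> M * T powr ((p + 1) / 2)" using v(3)[OF L(2)] by simp
    then show ?thesis using gs assms(1) by (auto simp: c'_def pos_divide_le_eq)
  qed
  have positive_solution: "\<exists>w. solution a p w \<and> everywhere_positive w \<and>
      (\<forall>s. periodic_fun_simple w s \<longleftrightarrow> (\<forall>t. u (t + s) = u t))"
    if gs: "ground_state a p L u u' M" for L u u' M
  proof -
    obtain b where b: "0 < b" "solution a p (\<lambda>t. b * u t)"
      using solution_of_ground_state[OF gs assms(2)] by blast
    moreover have "everywhere_positive (\<lambda>t. b * u t)"
      using gs b(1) by (auto simp: everywhere_positive_def ground_state_def)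
    ultimately show ?thesis
      by (intro exI[of _ "\<lambda>t. b * u t"]) (auto simp: periodic_fun_simple_def)
  qed
  obtain K :: nat where K: "\<And>k d u u' M. K \<le> k \<Longrightarrow> d dvd k \<Longrightarrow> d < k \<Longrightarrow> c' \<le> M
    \<Longrightarrow> ground_state a p (real k * T) u u' M \<Longrightarrow> \<not> (\<forall>t. u (t + real d * T) = u t)"
    by (rule minimal_period_threshold[OF assms(1,2) a A B c']) (rule that; assumption)
  have "\<exists>u. solution a p u \<and> everywhere_positive u \<and> periodic_fun_simple u T"
  proof -
    obtain u u' M where gs: "ground_state a p (real 1 * T) u u' M" using ground[of 1] by auto
    moreover have "u (t + T) = u t" for t using gs by (simp add: ground_state_def)
    ultimately show ?thesis using positive_solution by metis
  qed
  moreover have "\<exists>u. subharmonic_solution a p T k u \<and> everywhere_positive u" if k: "max 1 K \<le> k" for k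
  proof -
    obtain u u' M where gs: "ground_state a p (real k * T) u u' M" and M: "c' \<le> M"
      using ground[of k] k by auto
    have per: "u (t + real k * T) = u t" for t using gs by (simp add: ground_state_def)
    have "\<not> (\<forall>t. u (t + real l * T) = u t)" if l: "l \<in> {1..<k}" for l
    proof
      \<comment> \<open>a second period would make \<open>gcd k l\<close> a proper divisor of \<open>k\<close> that is a period\<close>
      assume "\<forall>t. u (t + real l * T) = u t"
      then have "\<forall>t. u (t + real (gcd k l) * T) = u t" using periodic_gcd[of u k T l] per by blast
      moreover have "gcd k l < k" using l by (intro le_less_trans[OF gcd_le2_nat]) auto
      ultimately show False using K[OF _ _ _ M gs, of "gcd k l"] k by auto
    qed
    moreover obtain w where "solution a p w" "everywhere_positive w"
      "\<And>s. periodic_fun_simple w s \<longleftrightarrow> (\<forall>t. u (t + s) = u t)"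
      using positive_solution[OF gs] by blast
    ultimately show ?thesis
      using per k by (intro exI[of _ w]) (auto simp: subharmonic_solution_def)
  qed
  ultimately show ?thesis by (intro conjI exI[of _ "max 1 K"]) auto
qed

end
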